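(* For each $n$ let $s=s_n\ge1$, $m=m_n>0$, $\mu=\mu_n>0$, and let $\mathcal{C}'$ denote the class of all subsets of $\{1,\ldots,n\}$ with cardinality $s$, $s+1$ or $s-1$. Assume $s=o(n)$ as $n\to\infty$. Let $\hat S_n$ be an arbitrary adaptive sensing estimation procedure (a sensing strategy with total budget $m$ together with a support estimator based on the resulting data) such that $$\lim_{n\to\infty}\ \max_{S\in\mathcal{C}'}\bigl\{\mathrm{FDR}(\hat S_n,S)+\mathrm{NDR}(\hat S_n,S)\bigr\}=0.$$ Then necessarily there is a sequence $\omega_n$ with $\lim_{n\to\infty}\omega_n=\infty$ such that the signal magnitude $x_{\min}=\mu$ satisfies $$x_{\min}\ \ge\ \omega_n\sqrt{\frac{n}{m}}.$$
   Context: Signal model: for $S\subseteq\{1,\ldots,n\}$ the signal $\vec{x}\in\mathbb{R}^n$ with support $S$ is given by $x_i=\mu$ if $i\in S$ and $x_i=0$ otherwise; for $S\neq\emptyset$, $x_{\min}=\min\{|x_i|:x_i\neq0\}=\mu$. Adaptive sensing: one observes $Y_k=x_{A_k}+\Gamma_k^{-1}W_k$, $k=1,2,\ldots$, where $A_k\in\{1,\ldots,n\}$ is the entry measured at time $k$ and $\Gamma_k^2$ is the precision of that measurement. The pair $(A_k,\Gamma_k)$ is chosen as a (possibly randomized) function of the past $\{Y_i,A_i,\Gamma_i\}_{i=1}^{k-1}$; the $W_k$ are standard normal, each $W_k$ being independent of $\{Y_i\}_{i=1}^{k-1}$, $\{A_i,\Gamma_i\}_{i=1}^{k}$ (and of any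 extra randomization). The sensing strategy is the collection of conditional distributions of $(A_k,\Gamma_k)$ given $\{Y_i,A_i,\Gamma_i\}_{i=1}^{k-1}$, for all $k$; it does not depend on the unknown $S$. The budget constraint is $\sum_{k=1}^\infty\Gamma_k^2\le m$ (almost surely). Convention: $\Gamma_k=0$ is allowed and means that no (informative) measurement is made at step $k$. $\mathbb{E}_S$ denotes expectation when the support is $S$. An estimator is a measurable function of $D=\{Y_i,A_i,\Gamma_i\}_{i=1}^\infty$ with values in the subsets of $\{1,\ldots,n\}$. The False Discovery Rate and Non-Discovery Rate are $$\mathrm{FDR}(\hat S,S)=\mathbb{E}_S\left[\frac{|\hat S\setminus S|}{|\hat S|}\right],\qquad \mathrm{NDR}(\hat S,S)=\mathbb{E}_S\left[\frac{|S\setminus\hat S|}{|S|}\right],$$ with the convention $0/0=0$. *)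

theory Defs
  imports "HOL-Probability.Probability" "HOL-Library.Landau_Symbols"
begin

definition signal :: "real \<Rightarrow> nat set \<Rightarrow> nat \<Rightarrow> real" where
  "signal \<mu> S i = (if i \<in> S then \<mu> else 0)"

definition x_min :: "nat \<Rightarrow> (nat \<Rightarrow> real) \<Rightarrow> real" where
  "x_min n x = Min {\<bar>x i\<bar> | i. i \<in> {1..n} \<and> x i \<noteq> 0}"

text \<open>
  Time is indexed from 0.  The observation made at time \<open>k\<close> is the triple
  \<open>(Y k, A k, \<Gamma> k)\<close>; a history of length \<open>k\<close> consists of the observations at times \<open>i < k\<close>.
\<close>

type_synonym observation = "real \<times> nat \<times> real"

definition action_space :: "nat \<Rightarrow> (nat \<times> real) measure" where
  "action_space n = count_space {1..n} \<Otimes>\<^sub>M borel"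

definition observation_space :: "nat \<Rightarrow> observation measure" where
  "observation_space n = borel \<Otimes>\<^sub>M action_space n"

definition history_space :: "nat \<Rightarrow> nat \<Rightarrow> (nat \<Rightarrow> observation) measure" where
  "history_space n k = PiM {..<k} (\<lambda>_. observation_space n)"

definition data_space :: "nat \<Rightarrow> (nat \<Rightarrow> observation) measure" where
  "data_space n = PiM UNIV (\<lambda>_. observation_space n)"

definition history ::
  "(nat \<Rightarrow> 'w \<Rightarrow> real) \<Rightarrow> (nat \<Rightarrow> 'w \<Rightarrow> nat) \<Rightarrow> (nat \<Rightarrow> 'w \<Rightarrow> real) \<Rightarrow> nat \<Rightarrow> 'w \<Rightarrow> nat \<Rightarrow> observation"
  where "history Y A \<Gamma> k \<omega> = (\<lambda>i\<in>{..<k}. (Y i \<omega>, A i \<omega>, \<Gamma> i \<omega>))"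

definition data ::
  "(nat \<Rightarrow> 'w \<Rightarrow> real) \<Rightarrow> (nat \<Rightarrow> 'w \<Rightarrow> nat) \<Rightarrow> (nat \<Rightarrow> 'w \<Rightarrow> real) \<Rightarrow> 'w \<Rightarrow> nat \<Rightarrow> observation"
  where "data Y A \<Gamma> \<omega> = (\<lambda>i. (Y i \<omega>, A i \<omega>, \<Gamma> i \<omega>))"

text \<open>
  A sensing strategy is given by its conditional distributions: the probability kernel
  \<open>\<kappa> k\<close> maps a history of length \<open>k\<close> to the law of the action (entry, square root of the
  precision) taken at time \<open>k\<close>.
\<close>

type_synonym strategy = "nat \<Rightarrow> (nat \<Rightarrow> observation) \<Rightarrow> (nat \<times> real) measure"

definition sensing_strategy :: "nat \<Rightarrow> strategy \<Rightarrow> bool" where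
  "sensing_strategy n \<kappa> \<longleftrightarrow>
     (\<forall>k. \<kappa> k \<in> history_space n k \<rightarrow>\<^sub>M prob_algebra (action_space n))"

definition estimator :: "nat \<Rightarrow> ((nat \<Rightarrow> observation) \<Rightarrow> nat set) \<Rightarrow> bool" where
  "estimator n T \<longleftrightarrow> T \<in> data_space n \<rightarrow>\<^sub>M count_space (Pow {1..n})"

text \<open>
  The sensing experiment on a signal \<open>x\<close> under the strategy \<open>\<kappa>\<close> with budget \<open>m\<close>.
  As \<open>w / 0 = 0\<close>, the formula \<open>x (A k) + W k / \<Gamma> k\<close> would reveal the entry exactly when
  \<open>\<Gamma> k = 0\<close>; zero precision means that nothing is measured, and the recorded value is then
  the constant 0.
\<close>

locale sensing_experiment = prob_space M for M :: "'w measure" +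
  fixes n :: nat and m :: real and x :: "nat \<Rightarrow> real" and \<kappa> :: strategy
    and Y :: "nat \<Rightarrow> 'w \<Rightarrow> real" and A :: "nat \<Rightarrow> 'w \<Rightarrow> nat"
    and \<Gamma> :: "nat \<Rightarrow> 'w \<Rightarrow> real" and W :: "nat \<Rightarrow> 'w \<Rightarrow> real"
  assumes A_measurable: "\<And>k. A k \<in> M \<rightarrow>\<^sub>M count_space {1..n}"
    and \<Gamma>_measurable: "\<And>k. \<Gamma> k \<in> borel_measurable M"
    and W_std_normal: "\<And>k. distributed M lborel (W k) std_normal_density"
    and W_indep: "\<And>k. indep_set (sets (vimage_algebra (space M) (W k) borel))
                   (sets (vimage_algebra (space M) (\<lambda>\<omega>. (history Y A \<Gamma> k \<omega>, A k \<omega>, \<Gamma> k \<omega>))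
                            (history_space n k \<Otimes>\<^sub>M action_space n)))"
    and Y_eq: "\<And>k \<omega>. \<omega> \<in> space M \<Longrightarrow>
                 Y k \<omega> = (if \<Gamma> k \<omega> = 0 then 0 else x (A k \<omega>) + W k \<omega> / \<Gamma> k \<omega>)"
    and action_cond_distr:
      "\<And>k H B. H \<in> sets (history_space n k) \<Longrightarrow> B \<in> sets (action_space n) \<Longrightarrow>
         prob {\<omega> \<in> space M. history Y A \<Gamma> k \<omega> \<in> H \<and> (A k \<omega>, \<Gamma> k \<omega>) \<in> B} =
         expectation (\<lambda>\<omega>. indicator H (history Y A \<Gamma> k \<omega>) * measure (\<kappa> k (history Y A \<Gamma> k \<omega>)) B)"
    and budget: "AE \<omega> in M. (\<Sum>k. ennreal ((\<Gamma> k \<omega>)\<^sup>2)) \<le> ennreal m"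

text \<open>Here \<open>T\<close> is a random subset; \<open>0 / 0 = 0\<close> is the convention of both rates.\<close>

definition FDR :: "'w measure \<Rightarrow> ('w \<Rightarrow> nat set) \<Rightarrow> nat set \<Rightarrow> real" where
  "FDR M T S = (LINT \<omega>|M. real (card (T \<omega> - S)) / real (card (T \<omega>)))"

definition NDR :: "'w measure \<Rightarrow> ('w \<Rightarrow> nat set) \<Rightarrow> nat set \<Rightarrow> real" where
  "NDR M T S = (LINT \<omega>|M. real (card (S - T \<omega>)) / real (card S))"

definition support_class :: "nat \<Rightarrow> nat \<Rightarrow> nat set set" where
  "support_class n s = {S. S \<subseteq> {1..n} \<and> card S \<in> {s, s + 1, s - 1}}"

end

theory Submission
  imports Defs
begin

text \<open>
  Compare a support \<open>S\<close> of size \<open>s - 1\<close> with \<open>insert i S\<close>. The two data laws have a likelihood ratio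
  whose accumulated information is \<open>\<mu>\<^sup>2\<close> times the precision spent on entry \<open>i\<close>; averaged over
  \<open>i \<notin> S\<close> this is at most \<open>\<mu>\<^sup>2 m / (n + 1 - s)\<close>. If that stays bounded, the events
  that the estimator misses \<open>i\<close> have comparable probabilities under both supports. But on average
  this probability is close to 1 under \<open>S\<close> (small FDR and \<open>s = o(n)\<close> force an estimate of size
  \<open>o(n)\<close>) and close to 0 under \<open>insert i S\<close> (small NDR).
\<close>

section \<open>Change of signal\<close>

text \<open>A probability under \<open>S\<close> has to be bounded by one under
  \<open>insert i S\<close>, so the likelihood ratio is needed from below, while change of measure
  only supplies means. The ratio for the opposite shift repairs this: in the product of the two
  ratios the terms linear in the noise cancel, leaving the exponential of minus the information. The
  opposite ratio has mean 1 under \<open>S\<close>, so Markov's inequality caps it and no logarithm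
  has to be integrated. It belongs to the signal with value -\<mu> at \<open>i\<close>, for which no
  experiment is given; hence means are computed from signal and strategy alone. The horizon is
  infinite, whereas ratios are formed for finite histories only. The bounds do not depend on the
  length of the history and so extend to all data events by approximation. No fixed \<open>S\<close>
  suffices in the last step: the NDR under \<open>insert i S\<close> controls an average over the
  members of that set, and \<open>i\<close> itself could be the member that is always missed.
  Averaging over all \<open>S\<close> of size \<open>s - 1\<close> lets every member of every set of
  size \<open>s\<close> take the role of \<open>i\<close>.\<close>

abbreviation std_normal_measure :: "real measure" where
  "std_normal_measure \<equiv> density lborel (\<lambda>w. ennreal (std_normal_density w))"

lemma prob_space_std_normal_measure: "prob_space std_normal_measure"
  using prob_space_normal_density[of 1 0] by simp

definition observe :: "(nat \<Rightarrow> real) \<Rightarrow> nat \<times> real \<Rightarrow> real \<Rightarrow> real" where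
  "observe x p w = (if snd p = 0 then 0 else x (fst p) + w / snd p)"

definition step ::
  "(nat \<Rightarrow> real) \<Rightarrow> strategy \<Rightarrow> nat \<Rightarrow> ((nat \<Rightarrow> observation) \<Rightarrow> ennreal) \<Rightarrow> (nat \<Rightarrow> observation) \<Rightarrow> ennreal"
  where "step x \<kappa> k f h =
    (\<integral>\<^sup>+p. (\<integral>\<^sup>+w. f (h(k := (observe x p w, p))) \<partial>std_normal_measure) \<partial>\<kappa> k h)"

text \<open>
  Backward recursion for the mean of \<open>f\<close> over histories of length \<open>k\<close>: it involves only the signal and
  the strategy, so it allows experiments on different probability spaces to be compared.
\<close>

primrec expect ::
  "(nat \<Rightarrow> real) \<Rightarrow> strategy \<Rightarrow> nat \<Rightarrow> ((nat \<Rightarrow> observation) \<Rightarrow> ennreal) \<Rightarrow> ennreal" where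
  "expect x \<kappa> 0 f = f (\<lambda>_. undefined)"
| "expect x \<kappa> (Suc k) f = expect x \<kappa> k (step x \<kappa> k f)"

text \<open>This is the quotient of the standard normal densities at \<open>w - c\<close> and at
  \<open>w\<close>, where \<open>c = \<delta> a * g\<close> and the noise
  \<open>w = g * (y - x a)\<close> is recovered from the observation. For \<open>g = 0\<close> it
  equals 1, as it must when nothing is measured.\<close>

definition likelihood_factor :: "(nat \<Rightarrow> real) \<Rightarrow> (nat \<Rightarrow> real) \<Rightarrow> observation \<Rightarrow> real" where
  "likelihood_factor x \<delta> = (\<lambda>(y, a, g). exp (\<delta> a * g\<^sup>2 * (y - x a) - (\<delta> a * g)\<^sup>2 / 2))"

text \<open>Only observation densities enter: both signals are sensed with the same strategy, so the
  conditional laws of the actions cancel.\<close>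

definition likelihood_ratio ::
  "(nat \<Rightarrow> real) \<Rightarrow> (nat \<Rightarrow> real) \<Rightarrow> nat \<Rightarrow> (nat \<Rightarrow> observation) \<Rightarrow> real" where
  "likelihood_ratio x \<delta> k h = (\<Prod>j<k. likelihood_factor x \<delta> (h j))"

lemma measurable_nat_fun [measurable]:
  fixes f :: "nat \<Rightarrow> real"
  shows "f \<in> borel_measurable (count_space {1..n})"
  by simp

lemma measurable_observe [measurable]:
  "(\<lambda>(p, w). observe x p w) \<in> borel_measurable (action_space n \<Otimes>\<^sub>M borel)"
  unfolding observe_def action_space_def by measurable

lemma measurable_likelihood_factor [measurable]:
  "likelihood_factor x \<delta> \<in> borel_measurable (observation_space n)"
  unfolding likelihood_factor_def observation_space_def action_space_def by measurable

lemma measurable_likelihood_ratio [measurable]: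
  "likelihood_ratio x \<delta> k \<in> borel_measurable (history_space n k)"
  unfolding likelihood_ratio_def history_space_def by measurable

lemma likelihood_ratio_Suc:
  "likelihood_ratio x \<delta> (Suc k) (h(k := z)) = likelihood_ratio x \<delta> k h * likelihood_factor x \<delta> z"
  by (simp add: likelihood_ratio_def)

lemma likelihood_ratio_pos: "likelihood_ratio x \<delta> k h > 0"
  unfolding likelihood_ratio_def likelihood_factor_def by (auto intro!: prod_pos split: prod.split)

lemma measurable_extend [measurable]:
  "(\<lambda>(h, z). h(k := z)) \<in> history_space n k \<Otimes>\<^sub>M observation_space n \<rightarrow>\<^sub>M history_space n (Suc k)"
  unfolding history_space_def lessThan_Suc by (rule measurable_add_dim)

lemma measurable_extend_observe:
  assumes [measurable]: "f \<in> borel_measurable (history_space n (Suc k))"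
  shows "(\<lambda>z. f ((fst (fst z))(k := (observe x (snd (fst z)) (snd z), snd (fst z)))))
           \<in> borel_measurable ((history_space n k \<Otimes>\<^sub>M action_space n) \<Otimes>\<^sub>M std_normal_measure)"
proof -
  have [measurable]: "(\<lambda>z. (observe x (snd (fst z)) (snd z), snd (fst z)))
          \<in> (history_space n k \<Otimes>\<^sub>M action_space n) \<Otimes>\<^sub>M std_normal_measure \<rightarrow>\<^sub>M observation_space n"
    unfolding observation_space_def by measurable
  have "(\<lambda>z. f ((\<lambda>(h, z). h(k := z)) (fst (fst z), (observe x (snd (fst z)) (snd z), snd (fst z)))))
           \<in> borel_measurable ((history_space n k \<Otimes>\<^sub>M action_space n) \<Otimes>\<^sub>M std_normal_measure)"
    by measurable
  then show ?thesis by (simp only: case_prod_conv)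
qed

lemma measurable_integrated_observation [measurable]:
  assumes "f \<in> borel_measurable (history_space n (Suc k))"
  shows "(\<lambda>(h, p). \<integral>\<^sup>+w. f (h(k := (observe x p w, p))) \<partial>std_normal_measure)
           \<in> borel_measurable (history_space n k \<Otimes>\<^sub>M action_space n)"
proof -
  interpret prob_space std_normal_measure by (rule prob_space_std_normal_measure)
  show ?thesis
    unfolding case_prod_beta
    using measurable_extend_observe[OF assms, of x]
    by (intro borel_measurable_nn_integral) (simp add: case_prod_beta)
qed

lemma measurable_step:
  assumes "sensing_strategy n \<kappa>" and [measurable]: "f \<in> borel_measurable (history_space n (Suc k))"
  shows "step x \<kappa> k f \<in> borel_measurable (history_space n k)"
proof -
  have "\<kappa> k \<in> history_space n k \<rightarrow>\<^sub>M subprob_algebra (action_space n)"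
    using assms(1) by (simp add: sensing_strategy_def measurable_prob_algebraD)
  then show ?thesis
    unfolding step_def by (rule nn_integral_measurable_subprob_algebra2[rotated]) measurable
qed

lemma strategy_kernel:
  assumes "sensing_strategy n \<kappa>" "h \<in> space (history_space n k)"
  shows "prob_space (\<kappa> k h)" "sets (\<kappa> k h) = sets (action_space n)"
proof -
  have "\<kappa> k h \<in> space (prob_algebra (action_space n))"
    using assms(1) by (intro measurable_space[OF _ assms(2)]) (simp add: sensing_strategy_def)
  then show "prob_space (\<kappa> k h)" "sets (\<kappa> k h) = sets (action_space n)"
    by (auto simp: space_prob_algebra)
qed

lemma extend_in_history_space:
  assumes "h \<in> space (history_space n k)" "p \<in> space (action_space n)"
  shows "h(k := (y, p)) \<in> space (history_space n (Suc k))"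
  using assms
  by (auto simp: history_space_def observation_space_def space_PiM space_pair_measure PiE_iff
      extensional_def)

lemma step_cong:
  assumes "sensing_strategy n \<kappa>" "h \<in> space (history_space n k)"
    and "\<And>h. h \<in> space (history_space n (Suc k)) \<Longrightarrow> f h = g h"
  shows "step x \<kappa> k f h = step x \<kappa> k g h"
  unfolding step_def
  using sets_eq_imp_space_eq[OF strategy_kernel(2)[OF assms(1,2)]]
  by (intro nn_integral_cong assms(3) extend_in_history_space[OF assms(2)]) auto

text \<open>The kernels are known to be probability measures on genuine histories only, so every
  rewriting under \<open>expect\<close> has to be restricted to
  \<open>history_space\<close>.\<close>

lemma expect_cong:
  assumes "sensing_strategy n \<kappa>" "\<And>h. h \<in> space (history_space n k) \<Longrightarrow> f h = g h"
  shows "expect x \<kappa> k f = expect x \<kappa> k g"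
  using assms(2)
proof (induction k arbitrary: f g)
  case 0
  then show ?case by (simp add: history_space_def space_PiM)
next
  case (Suc k)
  have "step x \<kappa> k f h = step x \<kappa> k g h" if "h \<in> space (history_space n k)" for h
    using that Suc.prems by (rule step_cong[OF assms(1)])
  then show ?case unfolding expect.simps by (rule Suc.IH)
qed

lemma expect_one:
  assumes "sensing_strategy n \<kappa>"
  shows "expect x \<kappa> k (\<lambda>_. 1) = 1"
proof (induction k)
  case (Suc k)
  interpret N: prob_space std_normal_measure by (rule prob_space_std_normal_measure)
  have "step x \<kappa> k (\<lambda>_. 1) h = 1" if "h \<in> space (history_space n k)" for h
    using prob_space.emeasure_space_1[OF strategy_kernel(1)[OF assms that]] N.emeasure_space_1
    by (simp add: step_def)
  then have "expect x \<kappa> (Suc k) (\<lambda>_. 1) = expect x \<kappa> k (\<lambda>_. 1)"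
    unfolding expect.simps by (rule expect_cong[OF assms])
  then show ?case using Suc by (simp only:)
qed simp

text \<open>Translation invariance of Lebesgue measure: adding \<open>\<delta>\<close> to the signal shifts the noise by \<open>g \<delta>\<close>.\<close>

lemma nn_integral_shift_observation:
  fixes G :: "observation \<Rightarrow> ennreal"
  assumes [measurable]: "(\<lambda>w. G (observe x p w, p)) \<in> borel_measurable borel"
  shows "(\<integral>\<^sup>+w. G (observe x p w, p) * ennreal (likelihood_factor x \<delta> (observe x p w, p)) \<partial>std_normal_measure)
       = (\<integral>\<^sup>+w. G (observe (\<lambda>a. x a + \<delta> a) p w, p) \<partial>std_normal_measure)"
proof (cases "snd p = 0")
  \<comment> \<open>Without precision both signals record the constant 0 and the factor is
    1.\<close>
  case True
  then show ?thesis by (simp add: observe_def likelihood_factor_def case_prod_beta)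
next
  case False
  obtain a g where p: "p = (a, g)" by force
  define c where "c = g * \<delta> a"
  have shift: "observe (\<lambda>a. x a + \<delta> a) p w = observe x p (c + w)" for w
    using False by (simp add: observe_def p c_def field_simps)
  have lik: "likelihood_factor x \<delta> (observe x p w, p) = exp (c * w - c\<^sup>2 / 2)" for w
    using False by (simp add: observe_def p c_def likelihood_factor_def power2_eq_square algebra_simps)
  have dens: "std_normal_density w * exp (c * w - c\<^sup>2 / 2) = std_normal_density (w - c)" for w
    by (simp add: std_normal_density_def power2_eq_square field_simps flip: exp_add)
  have [measurable]: "(\<lambda>w. G (observe x p (c + w), p)) \<in> borel_measurable borel"
    using measurable_compose[OF _ assms, of "\<lambda>w. c + w" borel] by simp
  have "(\<integral>\<^sup>+w. G (observe x p w, p) * ennreal (likelihood_factor x \<delta> (observe x p w, p)) \<partial>std_normal_measure)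
      = (\<integral>\<^sup>+w. ennreal (std_normal_density w) * (G (observe x p w, p) * ennreal (exp (c * w - c\<^sup>2 / 2))) \<partial>lborel)"
    by (simp add: lik nn_integral_density)
  also have "\<dots> = (\<integral>\<^sup>+w. ennreal (std_normal_density (w - c)) * G (observe x p w, p) \<partial>lborel)"
    by (intro nn_integral_cong) (simp add: dens[symmetric] ennreal_mult' mult_ac)
  also have "\<dots> = (\<integral>\<^sup>+w. ennreal (std_normal_density w) * G (observe x p (c + w), p) \<partial>lborel)"
    by (subst nn_integral_real_affine[where c=1 and t=c]) auto
  also have "\<dots> = (\<integral>\<^sup>+w. G (observe (\<lambda>a. x a + \<delta> a) p w, p) \<partial>std_normal_measure)"
    by (simp add: shift nn_integral_density)
  finally show ?thesis .
qed

text \<open>In each \<open>step\<close> the newest factor is absorbed by the shift of the noise,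
  while the older factors are constant there and go to the induction hypothesis. No experiment is
  involved, so \<delta> is arbitrary; this is applied both to the real shift and to its
  opposite.\<close>

lemma expect_likelihood_ratio:
  assumes \<kappa>: "sensing_strategy n \<kappa>" and "f \<in> borel_measurable (history_space n k)"
  shows "expect x \<kappa> k (\<lambda>h. f h * ennreal (likelihood_ratio x \<delta> k h))
       = expect (\<lambda>a. x a + \<delta> a) \<kappa> k f"
  using assms(2)
proof (induction k arbitrary: f)
  case 0
  then show ?case by (simp add: likelihood_ratio_def)
next
  case (Suc k)
  let ?x = "\<lambda>a. x a + \<delta> a"
  let ?F = "\<lambda>h. f h * ennreal (likelihood_ratio x \<delta> (Suc k) h)"
  have "step x \<kappa> k ?F h = step ?x \<kappa> k f h * ennreal (likelihood_ratio x \<delta> k h)"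
    if h: "h \<in> space (history_space n k)" for h
  proof -
    let ?L = "ennreal (likelihood_ratio x \<delta> k h)"
    let ?I = "\<lambda>p. \<integral>\<^sup>+w. f (h(k := (observe ?x p w, p))) \<partial>std_normal_measure"
    have pos: "0 \<le> likelihood_ratio x \<delta> k h" by (simp add: likelihood_ratio_pos less_imp_le)
    have "(\<integral>\<^sup>+w. ?F (h(k := (observe x p w, p))) \<partial>std_normal_measure) = ?I p * ?L"
      if p: "p \<in> space (\<kappa> k h)" for p
    proof -
      have p': "p \<in> space (action_space n)"
        using p sets_eq_imp_space_eq[OF strategy_kernel(2)[OF \<kappa> h]] by simp
      have meas: "(\<lambda>w. f (h(k := (observe z p w, p)))) \<in> borel_measurable borel" for z
        using measurable_compose[OF measurable_Pair1'[of "(h, p)" "history_space n k \<Otimes>\<^sub>M action_space n"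
              std_normal_measure] measurable_extend_observe[OF Suc.prems, of z]] h p'
        by (simp add: space_pair_measure fun_upd_def)
      have lmeas: "(\<lambda>w. likelihood_factor x \<delta> (observe x p w, p)) \<in> borel_measurable borel"
        by (cases p; cases "snd p = 0")
          (auto simp: likelihood_factor_def observe_def
            intro!: borel_measurable_continuous_onI continuous_intros)
      have "(\<integral>\<^sup>+w. ?F (h(k := (observe x p w, p))) \<partial>std_normal_measure)
          = (\<integral>\<^sup>+w. f (h(k := (observe x p w, p)))
               * ennreal (likelihood_factor x \<delta> (observe x p w, p)) * ?L \<partial>std_normal_measure)"
        by (simp only: likelihood_ratio_Suc ennreal_mult'[OF pos] mult.assoc mult.commute[of ?L])
      also have "\<dots> = (\<integral>\<^sup>+w. f (h(k := (observe x p w, p)))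
               * ennreal (likelihood_factor x \<delta> (observe x p w, p)) \<partial>std_normal_measure) * ?L"
        using meas[of x] lmeas by (intro nn_integral_multc) simp
      also have "\<dots> = ?I p * ?L"
        using nn_integral_shift_observation[of "\<lambda>z. f (h(k := z))" x p \<delta>] meas[of x] by simp
      finally show ?thesis .
    qed
    then have "step x \<kappa> k ?F h = (\<integral>\<^sup>+p. ?I p * ?L \<partial>\<kappa> k h)"
      unfolding step_def by (intro nn_integral_cong)
    also have "\<dots> = step ?x \<kappa> k f h * ?L"
      unfolding step_def
    proof (rule nn_integral_multc)
      have "?I \<in> borel_measurable (action_space n)"
        using measurable_compose[OF measurable_Pair1'[OF h, of "action_space n"]
            measurable_integrated_observation[OF Suc.prems, of ?x]] by (simp add: fun_upd_def)
      then show "?I \<in> borel_measurable (\<kappa> k h)"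
        by (subst measurable_cong_sets[OF strategy_kernel(2)[OF \<kappa> h] refl])
    qed
    finally show ?thesis .
  qed
  then have "expect x \<kappa> (Suc k) ?F
      = expect x \<kappa> k (\<lambda>h. step ?x \<kappa> k f h * ennreal (likelihood_ratio x \<delta> k h))"
    unfolding expect.simps by (rule expect_cong[OF \<kappa>])
  also have "\<dots> = expect ?x \<kappa> (Suc k) f"
    using Suc.IH[OF measurable_step[OF \<kappa> Suc.prems]] by simp
  finally show ?case .
qed

text \<open>Squared displacement of the standardized noise, that is, twice the Kullback-Leibler
  divergence between the two laws of this observation given the action. It does not depend on the
  observed value.\<close>

definition information :: "(nat \<Rightarrow> real) \<Rightarrow> observation \<Rightarrow> real" where
  "information \<delta> = (\<lambda>(y, a, g). (\<delta> a * g)\<^sup>2)"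

lemma measurable_information [measurable]:
  "information \<delta> \<in> borel_measurable (observation_space n)"
  unfolding information_def observation_space_def action_space_def by measurable

lemma information_nonneg: "0 \<le> information \<delta> z"
  by (simp add: information_def case_prod_beta)

section \<open>Law of the finite histories of an experiment\<close>

context sensing_experiment
begin

abbreviation hist :: "nat \<Rightarrow> 'w \<Rightarrow> nat \<Rightarrow> observation" where
  "hist \<equiv> history Y A \<Gamma>"

lemma W_measurable [measurable]: "W k \<in> borel_measurable M"
  using distributed_measurable[OF W_std_normal[of k]] by simp

lemma action_measurable [measurable]: "(\<lambda>\<omega>. (A k \<omega>, \<Gamma> k \<omega>)) \<in> M \<rightarrow>\<^sub>M action_space n"
  using A_measurable[of k] \<Gamma>_measurable[of k] unfolding action_space_def by measurable

lemma Y_observe: "\<omega> \<in> space M \<Longrightarrow> Y k \<omega> = observe x (A k \<omega>, \<Gamma> k \<omega>) (W k \<omega>)"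
  by (simp add: Y_eq observe_def)

lemma observation_measurable [measurable]:
  "(\<lambda>\<omega>. (Y k \<omega>, A k \<omega>, \<Gamma> k \<omega>)) \<in> M \<rightarrow>\<^sub>M observation_space n"
proof -
  have "(\<lambda>\<omega>. (\<lambda>(p, w). observe x p w) ((A k \<omega>, \<Gamma> k \<omega>), W k \<omega>)) \<in> borel_measurable M"
    by measurable
  then have [measurable]: "Y k \<in> borel_measurable M"
    by (subst measurable_cong[where g = "\<lambda>\<omega>. observe x (A k \<omega>, \<Gamma> k \<omega>) (W k \<omega>)"])
      (simp_all add: Y_observe)
  show ?thesis unfolding observation_space_def by measurable
qed

lemma history_measurable [measurable]: "hist k \<in> M \<rightarrow>\<^sub>M history_space n k"
  unfolding history_def[abs_def] history_space_def
  by (intro measurable_restrict observation_measurable)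

lemma data_measurable [measurable]: "data Y A \<Gamma> \<in> M \<rightarrow>\<^sub>M data_space n"
  unfolding data_def[abs_def] data_space_def
  using measurable_restrict[of UNIV "\<lambda>i \<omega>. (Y i \<omega>, A i \<omega>, \<Gamma> i \<omega>)" M "\<lambda>_. observation_space n",
      OF observation_measurable]
  by (simp only: restrict_UNIV)

lemma history_Suc: "hist (Suc k) \<omega> = (hist k \<omega>)(k := (Y k \<omega>, A k \<omega>, \<Gamma> k \<omega>))"
  by (auto simp: history_def fun_eq_iff restrict_def)

text \<open>The experiment specifies the conditional law of the action on rectangles
  \<open>H \<times> B\<close> only. These form an intersection-stable generator of the product
  space, so the two probability measures agree everywhere.\<close>

lemma distr_action:
  fixes k
  assumes \<kappa>: "sensing_strategy n \<kappa>"
  defines "S \<equiv> history_space n k \<Otimes>\<^sub>M action_space n"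
  shows "distr M S (\<lambda>\<omega>. (hist k \<omega>, A k \<omega>, \<Gamma> k \<omega>))
       = distr M (history_space n k) (hist k) \<bind> (\<lambda>h. distr (\<kappa> k h) S (Pair h))" (is "?N1 = ?N2")
proof -
  let ?H = "history_space n k" and ?A = "action_space n"
  let ?E = "{a \<times> b | a b. a \<in> sets ?H \<and> b \<in> sets ?A}"
  have kernel [measurable]: "\<kappa> k \<in> ?H \<rightarrow>\<^sub>M subprob_algebra ?A"
    using \<kappa> by (simp add: sensing_strategy_def measurable_prob_algebraD)
  have pair: "(\<lambda>h. distr (\<kappa> k h) S (Pair h)) \<in> ?H \<rightarrow>\<^sub>M subprob_algebra S"
    by (rule measurable_distr2[OF _ kernel]) (simp add: S_def)
  have ne: "space (distr M ?H (hist k)) \<noteq> {}"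
    using not_empty measurable_space[OF history_measurable, of _ k] by auto
  have joint [measurable]: "(\<lambda>\<omega>. (hist k \<omega>, A k \<omega>, \<Gamma> k \<omega>)) \<in> M \<rightarrow>\<^sub>M S"
    unfolding S_def by measurable
  have pair': "(\<lambda>h. distr (\<kappa> k h) S (Pair h)) \<in> distr M ?H (hist k) \<rightarrow>\<^sub>M subprob_algebra S"
    using pair by simp
  show ?thesis
  proof (rule measure_eqI_generator_eq[where E = ?E and \<Omega> = "space ?H \<times> space ?A"
        and A = "\<lambda>_. space ?H \<times> space ?A"])
    show "Int_stable ?E" by (rule Int_stable_pair_measure_generator)
    show "?E \<subseteq> Pow (space ?H \<times> space ?A)" by (rule pair_measure_closed)
    show "sets ?N1 = sigma_sets (space ?H \<times> space ?A) ?E"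
      by (simp add: S_def sets_pair_measure)
    show "sets ?N2 = sigma_sets (space ?H \<times> space ?A) ?E"
      using sets_bind[OF _ ne, of "\<lambda>h. distr (\<kappa> k h) S (Pair h)" S] by (simp add: S_def sets_pair_measure)
    show "range (\<lambda>_. space ?H \<times> space ?A) \<subseteq> ?E" by blast
    show "(\<Union>i::nat. space ?H \<times> space ?A) = space ?H \<times> space ?A" by simp
    show "emeasure ?N1 (space ?H \<times> space ?A) \<noteq> \<infinity>" for i :: nat
      by (subst emeasure_distr) (auto simp: S_def)
    fix X assume "X \<in> ?E"
    then obtain a b where X: "X = a \<times> b" and a [measurable]: "a \<in> sets ?H" and b [measurable]: "b \<in> sets ?A"
      by auto
    let ?f = "\<lambda>\<omega>. indicator a (hist k \<omega>) * measure (\<kappa> k (hist k \<omega>)) b"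
    have XS: "X \<in> sets S" unfolding X S_def by simp
    have "emeasure (distr (\<kappa> k h) S (Pair h)) X = indicator a h * emeasure (\<kappa> k h) b"
      if h: "h \<in> space ?H" for h
    proof -
      have "Pair h \<in> \<kappa> k h \<rightarrow>\<^sub>M S"
        unfolding S_def using measurable_Pair1'[OF h]
        by (subst measurable_cong_sets[OF strategy_kernel(2)[OF \<kappa> h] refl])
      moreover have "b \<subseteq> space (\<kappa> k h)"
        using sets.sets_into_space[OF b] sets_eq_imp_space_eq[OF strategy_kernel(2)[OF \<kappa> h]] by simp
      then have "Pair h -` X \<inter> space (\<kappa> k h) = (if h \<in> a then b else {})"
        by (auto simp: X)
      ultimately show ?thesis
        by (simp add: emeasure_distr XS)
    qed
    then have "emeasure ?N2 X = (\<integral>\<^sup>+h. indicator a h * emeasure (\<kappa> k h) b \<partial>distr M ?H (hist k))"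
      by (subst emeasure_bind[OF ne pair' XS]) (auto intro!: nn_integral_cong)
    also have "\<dots> = (\<integral>\<^sup>+\<omega>. indicator a (hist k \<omega>) * emeasure (\<kappa> k (hist k \<omega>)) b \<partial>M)"
      by (subst nn_integral_distr) measurable
    also have "\<dots> = (\<integral>\<^sup>+\<omega>. ennreal (?f \<omega>) \<partial>M)"
    proof (rule nn_integral_cong)
      fix \<omega> assume "\<omega> \<in> space M"
      then interpret K: prob_space "\<kappa> k (hist k \<omega>)"
        by (intro strategy_kernel(1)[OF \<kappa>] measurable_space[OF history_measurable])
      show "indicator a (hist k \<omega>) * emeasure (\<kappa> k (hist k \<omega>)) b = ennreal (?f \<omega>)"
        by (simp add: K.emeasure_eq_measure indicator_def)
    qed
    \<comment> \<open>\<open>action_cond_distr\<close> is stated with a Bochner integral of a real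
      function; boundedness by 1 supplies the integrability needed to return to it.\<close>
    also have "\<dots> = ennreal (expectation ?f)"
    proof (rule nn_integral_eq_integral)
      have "?f \<omega> \<le> 1" if "\<omega> \<in> space M" for \<omega>
      proof -
        interpret K: prob_space "\<kappa> k (hist k \<omega>)"
          using that by (intro strategy_kernel(1)[OF \<kappa>] measurable_space[OF history_measurable])
        show ?thesis by (simp add: indicator_def)
      qed
      moreover have "?f \<in> borel_measurable M"
        using measurable_compose[OF history_measurable measurable_compose[OF kernel measurable_measure_subprob_algebra[OF b]]]
        by measurable
      ultimately show "integrable M ?f"
        by (intro integrable_const_bound[where B = 1]) (auto simp: indicator_def)
    qed (simp add: indicator_def)
    also have "\<dots> = emeasure ?N1 X"
      using sets.sets_into_space[OF a] sets.sets_into_space[OF b] action_cond_distr[OF a b]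
      by (subst emeasure_distr[OF joint XS])
        (auto simp: X emeasure_eq_measure vimage_def Int_def conj_commute intro!: arg_cong[where f = prob])
    finally show "emeasure ?N1 X = emeasure ?N2 X" by simp
  qed
qed

lemma nn_integral_action:
  assumes \<kappa>: "sensing_strategy n \<kappa>"
    and g: "g \<in> borel_measurable (history_space n k \<Otimes>\<^sub>M action_space n)"
  shows "(\<integral>\<^sup>+\<omega>. g (hist k \<omega>, A k \<omega>, \<Gamma> k \<omega>) \<partial>M)
       = (\<integral>\<^sup>+\<omega>. (\<integral>\<^sup>+p. g (hist k \<omega>, p) \<partial>\<kappa> k (hist k \<omega>)) \<partial>M)"
proof -
  let ?H = "history_space n k" and ?S = "history_space n k \<Otimes>\<^sub>M action_space n"
  have kernel: "\<kappa> k \<in> ?H \<rightarrow>\<^sub>M subprob_algebra (action_space n)"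
    using \<kappa> by (simp add: sensing_strategy_def measurable_prob_algebraD)
  have pair: "(\<lambda>h. distr (\<kappa> k h) ?S (Pair h)) \<in> ?H \<rightarrow>\<^sub>M subprob_algebra ?S"
    by (rule measurable_distr2[OF _ kernel]) simp
  have inner: "(\<lambda>h. \<integral>\<^sup>+p. g (h, p) \<partial>\<kappa> k h) \<in> borel_measurable ?H"
    using g by (intro nn_integral_measurable_subprob_algebra2[OF _ kernel]) simp
  have "(\<integral>\<^sup>+\<omega>. g (hist k \<omega>, A k \<omega>, \<Gamma> k \<omega>) \<partial>M)
      = (\<integral>\<^sup>+z. g z \<partial>distr M ?S (\<lambda>\<omega>. (hist k \<omega>, A k \<omega>, \<Gamma> k \<omega>)))"
    using g by (subst nn_integral_distr) auto
  also have "\<dots> = (\<integral>\<^sup>+h. (\<integral>\<^sup>+z. g z \<partial>distr (\<kappa> k h) ?S (Pair h)) \<partial>distr M ?H (hist k))"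
    unfolding distr_action[OF \<kappa>] using g pair by (intro nn_integral_bind) simp_all
  also have "\<dots> = (\<integral>\<^sup>+h. (\<integral>\<^sup>+p. g (h, p) \<partial>\<kappa> k h) \<partial>distr M ?H (hist k))"
  proof (rule nn_integral_cong)
    fix h assume "h \<in> space (distr M ?H (hist k))"
    then have h: "h \<in> space ?H" by simp
    have "Pair h \<in> \<kappa> k h \<rightarrow>\<^sub>M ?S"
      using measurable_Pair1'[OF h] by (subst measurable_cong_sets[OF strategy_kernel(2)[OF \<kappa> h] refl])
    then show "(\<integral>\<^sup>+z. g z \<partial>distr (\<kappa> k h) ?S (Pair h)) = (\<integral>\<^sup>+p. g (h, p) \<partial>\<kappa> k h)"
      using g by (subst nn_integral_distr) auto
  qed
  also have "\<dots> = (\<integral>\<^sup>+\<omega>. (\<integral>\<^sup>+p. g (hist k \<omega>, p) \<partial>\<kappa> k (hist k \<omega>)) \<partial>M)"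
    using inner by (subst nn_integral_distr) auto
  finally show ?thesis .
qed

text \<open>The noise at time \<open>k\<close> is independent of the past together with the current
  action, so it can be integrated first with the action fixed. The action is then integrated against
  the kernel, which is the order of integration built into \<open>step\<close>.\<close>

lemma nn_integral_history_Suc:
  assumes \<kappa>: "sensing_strategy n \<kappa>" and f: "f \<in> borel_measurable (history_space n (Suc k))"
  shows "(\<integral>\<^sup>+\<omega>. f (hist (Suc k) \<omega>) \<partial>M) = (\<integral>\<^sup>+\<omega>. step x \<kappa> k f (hist k \<omega>) \<partial>M)"
proof -
  let ?S = "history_space n k \<Otimes>\<^sub>M action_space n"
  let ?Z = "\<lambda>\<omega>. (hist k \<omega>, A k \<omega>, \<Gamma> k \<omega>)"
  let ?F = "\<lambda>z. f ((fst (fst z))(k := (observe x (snd (fst z)) (snd z), snd (fst z))))"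
  let ?G = "\<lambda>(h, p). \<integral>\<^sup>+w. f (h(k := (observe x p w, p))) \<partial>std_normal_measure"
  interpret N: prob_space std_normal_measure by (rule prob_space_std_normal_measure)
  have distr_W: "distr M borel (W k) = std_normal_measure"
    using distributed_distr_eq_density[OF W_std_normal[of k]] distr_cong[of M M lborel borel "W k" "W k"]
    by simp
  have Z: "?Z \<in> M \<rightarrow>\<^sub>M ?S" by measurable
  have F: "?F \<in> borel_measurable (?S \<Otimes>\<^sub>M std_normal_measure)"
    by (rule measurable_extend_observe[OF f])
  have F_borel: "?F \<in> borel_measurable (?S \<Otimes>\<^sub>M borel)"
    by (rule measurable_cong_sets[OF sets_pair_measure_cong refl, THEN equalityD1, THEN subsetD, OF _ _ F]) simp_all
  have F_distr: "?F \<in> borel_measurable (distr M ?S ?Z \<Otimes>\<^sub>M std_normal_measure)"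
    by (rule measurable_cong_sets[OF sets_pair_measure_cong refl, THEN equalityD1, THEN subsetD, OF _ _ F]) simp_all
  interpret Z: prob_space "distr M ?S ?Z" by (rule prob_space_distr[OF Z])
  \<comment> \<open>Independence is used only here: it turns the joint law into a product measure,
    as Fubini's theorem requires.\<close>
  have joint: "distr M ?S ?Z \<Otimes>\<^sub>M std_normal_measure = distr M (?S \<Otimes>\<^sub>M borel) (\<lambda>\<omega>. (?Z \<omega>, W k \<omega>))"
  proof (rule pair_measure_eqI)
    show "sets (distr M ?S ?Z \<Otimes>\<^sub>M std_normal_measure) = sets (distr M (?S \<Otimes>\<^sub>M borel) (\<lambda>\<omega>. (?Z \<omega>, W k \<omega>)))"
      unfolding sets_distr by (rule sets_pair_measure_cong) simp_all
    fix a b assume "a \<in> sets (distr M ?S ?Z)" "b \<in> sets std_normal_measure"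
    then have a: "a \<in> sets ?S" and b: "b \<in> sets borel" by simp_all
    have "prob ((W k -` b \<inter> space M) \<inter> (?Z -` a \<inter> space M)) = prob (W k -` b \<inter> space M) * prob (?Z -` a \<inter> space M)"
      using a b by (intro indep_setD[OF W_indep[of k]] in_vimage_algebra)
    moreover have "(\<lambda>\<omega>. (?Z \<omega>, W k \<omega>)) -` (a \<times> b) \<inter> space M = (W k -` b \<inter> space M) \<inter> (?Z -` a \<inter> space M)"
      by auto
    moreover have "emeasure (distr M (?S \<Otimes>\<^sub>M borel) (\<lambda>\<omega>. (?Z \<omega>, W k \<omega>))) (a \<times> b)
        = prob ((\<lambda>\<omega>. (?Z \<omega>, W k \<omega>)) -` (a \<times> b) \<inter> space M)"
      using a b Z by (subst emeasure_distr) (auto simp: emeasure_eq_measure)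
    ultimately show "emeasure (distr M ?S ?Z) a * emeasure std_normal_measure b
        = emeasure (distr M (?S \<Otimes>\<^sub>M borel) (\<lambda>\<omega>. (?Z \<omega>, W k \<omega>))) (a \<times> b)"
      unfolding distr_W[symmetric] using a b Z
      by (simp add: emeasure_distr emeasure_eq_measure mult.commute flip: ennreal_mult)
  qed unfold_locales
  have "(\<integral>\<^sup>+\<omega>. f (hist (Suc k) \<omega>) \<partial>M) = (\<integral>\<^sup>+\<omega>. ?F (?Z \<omega>, W k \<omega>) \<partial>M)"
    by (intro nn_integral_cong) (simp add: history_Suc Y_observe)
  also have "\<dots> = (\<integral>\<^sup>+z. ?F z \<partial>distr M (?S \<Otimes>\<^sub>M borel) (\<lambda>\<omega>. (?Z \<omega>, W k \<omega>)))"
    using Z F_borel by (subst nn_integral_distr) auto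
  also have "\<dots> = (\<integral>\<^sup>+z. (\<integral>\<^sup>+w. ?F (z, w) \<partial>std_normal_measure) \<partial>distr M ?S ?Z)"
    unfolding joint[symmetric] by (rule N.nn_integral_fst[OF F_distr, symmetric])
  also have "\<dots> = (\<integral>\<^sup>+z. ?G z \<partial>distr M ?S ?Z)"
    by (simp only: case_prod_beta fst_conv snd_conv)
  also have "\<dots> = (\<integral>\<^sup>+\<omega>. ?G (?Z \<omega>) \<partial>M)"
    using measurable_integrated_observation[OF f] Z by (intro nn_integral_distr) auto
  also have "\<dots> = (\<integral>\<^sup>+\<omega>. step x \<kappa> k f (hist k \<omega>) \<partial>M)"
    using nn_integral_action[OF \<kappa> measurable_integrated_observation[OF f, of x]]
    by (simp only: step_def case_prod_conv)
  finally show ?thesis .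
qed

text \<open>The right-hand side no longer mentions the probability space; this is the bridge over
  which two experiments with the same strategy are compared.\<close>

lemma nn_integral_history:
  assumes \<kappa>: "sensing_strategy n \<kappa>" and "f \<in> borel_measurable (history_space n k)"
  shows "(\<integral>\<^sup>+\<omega>. f (hist k \<omega>) \<partial>M) = expect x \<kappa> k f"
  using assms(2)
proof (induction k arbitrary: f)
  case 0
  \<comment> \<open>The only history of length 0 is undefined everywhere, which is the argument in
    the base case of \<open>expect\<close>.\<close>
  then show ?case by (simp add: history_def emeasure_space_1 restrict_def)
next
  case (Suc k)
  show ?case
    unfolding nn_integral_history_Suc[OF \<kappa> Suc.prems] expect.simps
    by (rule Suc.IH[OF measurable_step[OF \<kappa> Suc.prems]])
qed

end

section \<open>Comparison of two experiments on finite histories\<close>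

lemma likelihood_ratio_uminus:
  "likelihood_ratio x (\<lambda>a. - \<delta> a) k h * likelihood_ratio x \<delta> k h = exp (- (\<Sum>j<k. information \<delta> (h j)))"
  unfolding likelihood_ratio_def likelihood_factor_def information_def
  by (simp add: case_prod_beta exp_sum flip: prod.distrib sum_negf exp_add)

text \<open>
  Unless the accumulated information exceeds \<open>l\<close> or the reverse likelihood ratio exceeds \<open>B\<close>,
  the likelihood ratio is at least \<open>exp (- l) / B\<close>.
\<close>

lemma one_le_likelihood_bound:
  fixes B l :: real
  assumes "B > 0" "l > 0"
  shows "1 \<le> B * exp l * likelihood_ratio x \<delta> k h + likelihood_ratio x (\<lambda>a. - \<delta> a) k h / B
              + (\<Sum>j<k. information \<delta> (h j)) / l"
proof -
  let ?L = "likelihood_ratio x \<delta> k h" and ?L' = "likelihood_ratio x (\<lambda>a. - \<delta> a) k h"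
  let ?V = "\<Sum>j<k. information \<delta> (h j)"
  have pos: "?L > 0" "?L' > 0" "?V \<ge> 0"
    by (auto simp: likelihood_ratio_pos information_nonneg sum_nonneg)
  have nonneg: "B * exp l * ?L \<ge> 0" "?L' / B \<ge> 0" "?V / l \<ge> 0"
    using pos assms by simp_all
  consider "?V \<ge> l" | "?L' \<ge> B" | "?V < l" "?L' < B" by linarith
  then show ?thesis
  proof cases
    case 1
    then have "1 \<le> ?V / l" using assms by simp
    then show ?thesis using nonneg by linarith
  next
    case 2
    then have "1 \<le> ?L' / B" using assms by simp
    then show ?thesis using nonneg by linarith
  next
    case 3
    have "exp (- l) \<le> exp (- ?V)" using 3 by simp
    also have "\<dots> = ?L' * ?L" by (simp add: likelihood_ratio_uminus)
    also have "\<dots> \<le> B * ?L" using 3 pos by (intro mult_right_mono) auto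
    finally have "1 \<le> B * exp l * ?L"
      by (simp add: exp_minus field_simps)
    then show ?thesis using nonneg by linarith
  qed
qed

locale sensing_experiment_pair =
  E0: sensing_experiment M0 n m0 x \<kappa> Y0 A0 \<Gamma>0 W0 +
  E1: sensing_experiment M1 n m1 "\<lambda>a. x a + \<delta> a" \<kappa> Y1 A1 \<Gamma>1 W1
  for n m0 m1 x \<delta> \<kappa>
    and M0 :: "'w measure" and Y0 A0 \<Gamma>0 W0
    and M1 :: "'v measure" and Y1 A1 \<Gamma>1 W1 +
  assumes strategy: "sensing_strategy n \<kappa>"
begin

text \<open>\<open>one_le_likelihood_bound\<close> is integrated over \<open>C\<close> under the
  first experiment. Its first term becomes a probability in the second experiment by change of
  signal; in the other two the indicator of \<open>C\<close> is dropped, which leaves Markov bounds.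
  The information is thus averaged under the first experiment only, the one that stays fixed when
  \<open>i\<close> varies.\<close>

lemma history_event_bound:
  fixes B l :: real
  assumes C [measurable]: "C \<in> sets (history_space n k)" and "B > 0" "l > 0"
  shows "emeasure M0 (E0.hist k -` C \<inter> space M0)
       \<le> ennreal (B * exp l) * emeasure M1 (E1.hist k -` C \<inter> space M1) + ennreal (1 / B)
         + (\<integral>\<^sup>+\<omega>. (\<Sum>j<k. ennreal (information \<delta> (Y0 j \<omega>, A0 j \<omega>, \<Gamma>0 j \<omega>))) \<partial>M0) * ennreal (1 / l)"
proof -
  let ?H = "history_space n k"
  let ?L = "likelihood_ratio x \<delta> k" and ?L' = "likelihood_ratio x (\<lambda>a. - \<delta> a) k"
  let ?V = "\<lambda>h. \<Sum>j<k. ennreal (information \<delta> (h j))"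
  let ?K = "ennreal (B * exp l)"
  have V [measurable]: "?V \<in> borel_measurable ?H"
    unfolding history_space_def by measurable
  have "(\<integral>\<^sup>+\<omega>. indicator C (E0.hist k \<omega>) \<partial>M0) = (\<integral>\<^sup>+\<omega>. indicator (E0.hist k -` C \<inter> space M0) \<omega> \<partial>M0)"
    by (intro nn_integral_cong) (simp add: indicator_def)
  then have emb: "emeasure M0 (E0.hist k -` C \<inter> space M0) = (\<integral>\<^sup>+\<omega>. indicator C (E0.hist k \<omega>) \<partial>M0)"
    by simp
  have "(\<integral>\<^sup>+\<omega>. indicator C (E1.hist k \<omega>) \<partial>M1) = (\<integral>\<^sup>+\<omega>. indicator (E1.hist k -` C \<inter> space M1) \<omega> \<partial>M1)"
    by (intro nn_integral_cong) (simp add: indicator_def)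
  then have emb1: "emeasure M1 (E1.hist k -` C \<inter> space M1) = (\<integral>\<^sup>+\<omega>. indicator C (E1.hist k \<omega>) \<partial>M1)"
    by simp
  have pointwise: "indicator C h \<le> ?K * (indicator C h * ennreal (?L h)) + ennreal (?L' h) * ennreal (1 / B)
      + ?V h * ennreal (1 / l)" for h
  proof (cases "h \<in> C")
    case True
    have nonneg: "0 \<le> (\<Sum>j<k. information \<delta> (h j))" "0 \<le> ?L h" "0 \<le> ?L' h"
      by (auto simp: information_nonneg sum_nonneg likelihood_ratio_pos less_imp_le)
    have "ennreal 1 \<le> ennreal (B * exp l * ?L h + ?L' h / B + (\<Sum>j<k. information \<delta> (h j)) / l)"
      using one_le_likelihood_bound[OF assms(2,3)] by (rule ennreal_leI)
    also have "\<dots> = ?K * ennreal (?L h) + ennreal (?L' h) * ennreal (1 / B)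
        + ennreal (\<Sum>j<k. information \<delta> (h j)) * ennreal (1 / l)"
      using nonneg assms(2,3) by (simp flip: ennreal_mult ennreal_plus)
    also have "ennreal (\<Sum>j<k. information \<delta> (h j)) = ?V h"
      by (simp add: sum_ennreal information_nonneg)
    finally show ?thesis using True by simp
  qed simp
  have "(\<integral>\<^sup>+\<omega>. indicator C (E0.hist k \<omega>) \<partial>M0)
      \<le> (\<integral>\<^sup>+\<omega>. ?K * (indicator C (E0.hist k \<omega>) * ennreal (?L (E0.hist k \<omega>)))
           + ennreal (?L' (E0.hist k \<omega>)) * ennreal (1 / B) + ?V (E0.hist k \<omega>) * ennreal (1 / l) \<partial>M0)"
    by (intro nn_integral_mono pointwise)
  also have "\<dots> = ?K * (\<integral>\<^sup>+\<omega>. indicator C (E0.hist k \<omega>) * ennreal (?L (E0.hist k \<omega>)) \<partial>M0)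
      + (\<integral>\<^sup>+\<omega>. ennreal (?L' (E0.hist k \<omega>)) \<partial>M0) * ennreal (1 / B)
      + (\<integral>\<^sup>+\<omega>. ?V (E0.hist k \<omega>) \<partial>M0) * ennreal (1 / l)"
  proof -
    have [measurable]: "(\<lambda>\<omega>. indicator C (E0.hist k \<omega>) * ennreal (?L (E0.hist k \<omega>))) \<in> borel_measurable M0"
      "(\<lambda>\<omega>. ennreal (?L' (E0.hist k \<omega>))) \<in> borel_measurable M0"
      "(\<lambda>\<omega>. ?V (E0.hist k \<omega>)) \<in> borel_measurable M0"
      by (rule measurable_compose[OF E0.history_measurable[of k]], measurable)+
    show ?thesis
      by (simp add: nn_integral_add nn_integral_cmult nn_integral_multc)
  qed
  also have "(\<integral>\<^sup>+\<omega>. indicator C (E0.hist k \<omega>) * ennreal (?L (E0.hist k \<omega>)) \<partial>M0)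
      = (\<integral>\<^sup>+\<omega>. indicator C (E1.hist k \<omega>) \<partial>M1)"
  proof -
    have "(\<integral>\<^sup>+\<omega>. indicator C (E0.hist k \<omega>) * ennreal (?L (E0.hist k \<omega>)) \<partial>M0)
        = expect x \<kappa> k (\<lambda>h. indicator C h * ennreal (?L h))"
      by (rule E0.nn_integral_history[OF strategy]) measurable
    also have "\<dots> = expect (\<lambda>a. x a + \<delta> a) \<kappa> k (indicator C)"
      by (rule expect_likelihood_ratio[OF strategy]) measurable
    also have "\<dots> = (\<integral>\<^sup>+\<omega>. indicator C (E1.hist k \<omega>) \<partial>M1)"
      by (rule E1.nn_integral_history[OF strategy, symmetric]) measurable
    finally show ?thesis .
  qed
  \<comment> \<open>\<open>?L'\<close> is the likelihood ratio of the signal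
    \<open>x - \<delta>\<close> to \<open>x\<close>, so its mean is the total mass that
    \<open>expect\<close> assigns under that signal.\<close>
  also have "(\<integral>\<^sup>+\<omega>. ennreal (?L' (E0.hist k \<omega>)) \<partial>M0) = 1"
  proof -
    have "(\<integral>\<^sup>+\<omega>. ennreal (?L' (E0.hist k \<omega>)) \<partial>M0) = expect x \<kappa> k (\<lambda>h. 1 * ennreal (?L' h))"
      by (subst E0.nn_integral_history[OF strategy]) auto
    also have "\<dots> = 1"
      by (subst expect_likelihood_ratio[OF strategy]) (auto simp: expect_one[OF strategy])
    finally show ?thesis .
  qed
  also have "(\<integral>\<^sup>+\<omega>. ?V (E0.hist k \<omega>) \<partial>M0)
      = (\<integral>\<^sup>+\<omega>. (\<Sum>j<k. ennreal (information \<delta> (Y0 j \<omega>, A0 j \<omega>, \<Gamma>0 j \<omega>))) \<partial>M0)"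
    by (simp add: history_def)
  finally show ?thesis unfolding emb emb1 by simp
qed

end

section \<open>From finite histories to the full data\<close>

text \<open>Induction on the generation of the sigma-algebra. One set \<open>C\<close> must serve
  both measures at once, since the bound on finite histories relates the two probabilities of the
  same event. A countable union is first cut to a finite one, using continuity from below for both
  measures.\<close>

lemma approximate_by_algebra:
  assumes M: "finite_measure M" and N: "finite_measure N" and "algebra \<Omega> \<A>"
    and sets_M: "sets M = sigma_sets \<Omega> \<A>" and sets_N: "sets N = sets M"
    and "E \<in> sets M" "(e::real) > 0"
  shows "\<exists>C\<in>\<A>. measure M (sym_diff E C) < e \<and> measure N (sym_diff E C) < e"
proof -
  interpret M: finite_measure M by fact
  interpret N: finite_measure N by fact
  interpret algebra \<Omega> \<A> by fact
  have \<A>_sets: "C \<in> sets M" if "C \<in> \<A>" for C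
    using that by (simp add: sets_M)
  have "E \<in> sigma_sets \<Omega> \<A>" using assms(6) by (simp add: sets_M)
  then show ?thesis using \<open>e > 0\<close>
  proof (induction arbitrary: e)
    case (Basic a)
    then show ?case by (intro bexI[of _ a]) auto
  next
    case Empty
    then show ?case by (intro bexI[of _ "{}"]) auto
  next
    case (Compl a)
    then obtain C where C: "C \<in> \<A>" "measure M (sym_diff a C) < e" "measure N (sym_diff a C) < e"
      by blast
    have "a \<subseteq> \<Omega>" using sigma_sets_into_sp[OF space_closed Compl.hyps] .
    then have "sym_diff (\<Omega> - a) (\<Omega> - C) = sym_diff a C"
      using sets_into_space[OF C(1)] by blast
    then show ?case using C by (intro bexI[of _ "\<Omega> - C"]) auto
  next
    case (Union a)
    have a: "a i \<in> sets M" for i using Union.hyps by (simp add: sets_M)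
    define U where "U k = (\<Union>i<k. a i)" for k
    have U: "U k \<in> sets M" for k using a by (auto simp: U_def)
    have union_U: "(\<Union>k. U k) = (\<Union>i. a i)" by (auto simp: U_def)
    have "incseq U" by (force simp: U_def incseq_def)
    then have "(\<lambda>k. measure M (U k)) \<longlonglongrightarrow> measure M (\<Union>i. a i)"
      "(\<lambda>k. measure N (U k)) \<longlonglongrightarrow> measure N (\<Union>i. a i)"
      using M.finite_Lim_measure_incseq[of U] N.finite_Lim_measure_incseq[of U] U
      by (auto simp: union_U sets_N)
    then have "\<forall>\<^sub>F k in sequentially. measure M (U k) > measure M (\<Union>i. a i) - e / 2"
      "\<forall>\<^sub>F k in sequentially. measure N (U k) > measure N (\<Union>i. a i) - e / 2"
      using Union.prems by (auto intro: order_tendstoD(1))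
    then have "\<forall>\<^sub>F k in sequentially. measure M (U k) > measure M (\<Union>i. a i) - e / 2
        \<and> measure N (U k) > measure N (\<Union>i. a i) - e / 2"
      by (rule eventually_conj)
    then obtain k where k: "measure M (U k) > measure M (\<Union>i. a i) - e / 2"
      "measure N (U k) > measure N (\<Union>i. a i) - e / 2"
      by (auto simp: eventually_sequentially)
    \<comment> \<open>Half of \<open>e\<close> pays for cutting the union, the other half for
      \<open>k\<close> approximations at cost \<open>d\<close> each; the added 1 covers
      \<open>k = 0\<close>.\<close>
    define d where "d = e / (2 * (real k + 1))"
    have "d > 0" using Union.prems by (simp add: d_def)
    then have "\<forall>i. \<exists>C\<in>\<A>. measure M (sym_diff (a i) C) < d \<and> measure N (sym_diff (a i) C) < d"
      using Union.IH by blast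
    then obtain C where C: "\<And>i. C i \<in> \<A>" "\<And>i. measure M (sym_diff (a i) (C i)) < d"
      "\<And>i. measure N (sym_diff (a i) (C i)) < d"
      by metis
    have bound: "measure L (sym_diff (\<Union>i. a i) (\<Union>i<k. C i)) < e"
      if L: "finite_measure L" "sets L = sets M" "measure L (U k) > measure L (\<Union>i. a i) - e / 2"
        "\<And>i. measure L (sym_diff (a i) (C i)) < d" for L
    proof -
      interpret L: finite_measure L by fact
      have m: "a i \<in> sets L" "U k \<in> sets L" "C i \<in> sets L" for i
        using a U \<A>_sets[OF C(1)] L(2) by auto
      have "measure L (sym_diff (\<Union>i. a i) (\<Union>i<k. C i))
          \<le> measure L (((\<Union>i. a i) - U k) \<union> (\<Union>i<k. sym_diff (a i) (C i)))"
        using m by (intro L.finite_measure_mono) (auto simp: U_def)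
      also have "\<dots> \<le> measure L ((\<Union>i. a i) - U k) + measure L (\<Union>i<k. sym_diff (a i) (C i))"
        using m by (intro measure_Un_le) auto
      also have "measure L ((\<Union>i. a i) - U k) = measure L (\<Union>i. a i) - measure L (U k)"
        using m by (intro L.finite_measure_Diff) (auto simp: U_def)
      also have "\<dots> < e / 2" using L(3) by simp
      also have "measure L (\<Union>i<k. sym_diff (a i) (C i)) \<le> (\<Sum>i<k. measure L (sym_diff (a i) (C i)))"
        using m by (intro L.finite_measure_subadditive_finite) auto
      also have "\<dots> \<le> (\<Sum>i<k. d)" using L(4) by (intro sum_mono less_imp_le)
      also have "\<dots> \<le> e / 2"
        using Union.prems by (simp add: d_def field_simps)
      finally show ?thesis by simp
    qed
    show ?case
    proof (intro bexI[of _ "\<Union>i<k. C i"] conjI)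
      show "measure M (sym_diff (\<Union>i. a i) (\<Union>i<k. C i)) < e"
        using bound[OF M] k C by simp
      show "measure N (sym_diff (\<Union>i. a i) (\<Union>i<k. C i)) < e"
        using bound[OF N] k C sets_N by simp
      show "(\<Union>i<k. C i) \<in> \<A>" using C by (intro finite_UN) auto
    qed
  qed
qed

text \<open>Cylinders over initial segments of time, chosen instead of the usual product generators
  because they form an algebra whose members are exactly the events decided by some finite
  history.\<close>

definition history_events :: "nat \<Rightarrow> (nat \<Rightarrow> observation) set set" where
  "history_events n = {(\<lambda>f. restrict f {..<k}) -` B \<inter> space (data_space n) | k B. B \<in> sets (history_space n k)}"

lemma measurable_restrict_data: "(\<lambda>f. restrict f {..<k}) \<in> data_space n \<rightarrow>\<^sub>M history_space n k"
  unfolding data_space_def history_space_def by (rule measurable_restrict_subset) simp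

lemma measurable_restrict_history:
  "j \<le> k \<Longrightarrow> (\<lambda>f. restrict f {..<j}) \<in> history_space n k \<rightarrow>\<^sub>M history_space n j"
  unfolding history_space_def by (rule measurable_restrict_subset) simp

text \<open>An event decided by time \<open>j\<close> is also decided by any later time; two events
  with different horizons can therefore be united at the larger one.\<close>

lemma history_events_extend:
  assumes "j \<le> k" "B \<in> sets (history_space n j)"
  shows "\<exists>B'\<in>sets (history_space n k). (\<lambda>f. restrict f {..<j}) -` B \<inter> space (data_space n)
           = (\<lambda>f. restrict f {..<k}) -` B' \<inter> space (data_space n)"
proof
  let ?B' = "(\<lambda>f. restrict f {..<j}) -` B \<inter> space (history_space n k)"
  show "?B' \<in> sets (history_space n k)"
    using assms by (intro measurable_sets[OF measurable_restrict_history])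
  have "restrict (restrict f {..<k}) {..<j} = restrict f {..<j}" for f :: "nat \<Rightarrow> observation"
    using assms(1) by (auto simp: restrict_def fun_eq_iff)
  then show "(\<lambda>f. restrict f {..<j}) -` B \<inter> space (data_space n)
      = (\<lambda>f. restrict f {..<k}) -` ?B' \<inter> space (data_space n)"
    using measurable_space[OF measurable_restrict_data[of k n]] by auto
qed

lemma algebra_history_events: "algebra (space (data_space n)) (history_events n)"
  unfolding algebra_iff_Un
proof (intro conjI ballI)
  show "history_events n \<subseteq> Pow (space (data_space n))"
    by (auto simp: history_events_def)
  show "{} \<in> history_events n"
    by (auto simp: history_events_def intro!: exI[of _ "{}"])
next
  fix a assume "a \<in> history_events n"
  then obtain k B where a: "a = (\<lambda>f. restrict f {..<k}) -` B \<inter> space (data_space n)"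
    and B: "B \<in> sets (history_space n k)" by (auto simp: history_events_def)
  have "space (data_space n) - a
      = (\<lambda>f. restrict f {..<k}) -` (space (history_space n k) - B) \<inter> space (data_space n)"
    unfolding a using measurable_space[OF measurable_restrict_data[of k n]] by auto
  moreover have "space (history_space n k) - B \<in> sets (history_space n k)" using B by auto
  ultimately show "space (data_space n) - a \<in> history_events n"
    unfolding history_events_def by blast
next
  fix a b assume "a \<in> history_events n" "b \<in> history_events n"
  then obtain j k B C where a: "a = (\<lambda>f. restrict f {..<j}) -` B \<inter> space (data_space n)"
    and B: "B \<in> sets (history_space n j)"
    and b: "b = (\<lambda>f. restrict f {..<k}) -` C \<inter> space (data_space n)"
    and C: "C \<in> sets (history_space n k)" by (auto simp: history_events_def)
  obtain B' C' where B': "B' \<in> sets (history_space n (max j k))"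
      "a = (\<lambda>f. restrict f {..<max j k}) -` B' \<inter> space (data_space n)"
    and C': "C' \<in> sets (history_space n (max j k))"
      "b = (\<lambda>f. restrict f {..<max j k}) -` C' \<inter> space (data_space n)"
    using history_events_extend[OF max.cobounded1 B, of k] history_events_extend[OF max.cobounded2 C, of j]
    unfolding a b by blast
  have "a \<union> b = (\<lambda>f. restrict f {..<max j k}) -` (B' \<union> C') \<inter> space (data_space n)"
    using B' C' by blast
  moreover have "B' \<union> C' \<in> sets (history_space n (max j k))" using B' C' by auto
  ultimately show "a \<union> b \<in> history_events n"
    unfolding history_events_def by blast
qed

text \<open>A condition on coordinate \<open>i\<close> is already decided by the history of length
  \<open>Suc i\<close>, so the one-coordinate generators are history events; conversely, restriction
  to an initial segment is measurable.\<close>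

lemma sets_data_space: "sets (data_space n) = sigma_sets (space (data_space n)) (history_events n)"
proof -
  let ?O = "space (data_space n)"
  let ?G = "{{f \<in> \<Pi>\<^sub>E i\<in>UNIV. space (observation_space n). f i \<in> A} | i A.
      i \<in> (UNIV::nat set) \<and> A \<in> sets (observation_space n)}"
  have O: "?O = (\<Pi>\<^sub>E i\<in>UNIV. space (observation_space n))"
    by (simp add: data_space_def space_PiM)
  have data: "sets (data_space n) = sigma_sets ?O ?G"
    unfolding O unfolding data_space_def by (rule sets_PiM_single)
  also have "\<dots> = sigma_sets ?O (history_events n)"
  proof (rule sigma_sets_eqI)
    fix a assume "a \<in> ?G"
    then obtain i A where a: "a = {f \<in> ?O. f i \<in> A}" and A [measurable]: "A \<in> sets (observation_space n)"
      unfolding O by auto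
    let ?B = "{f \<in> space (history_space n (Suc i)). f i \<in> A}"
    have "?B \<in> sets (history_space n (Suc i))"
      unfolding history_space_def by measurable
    moreover have "a = (\<lambda>f. restrict f {..<Suc i}) -` ?B \<inter> ?O"
      unfolding a using measurable_space[OF measurable_restrict_data[of "Suc i" n]] by auto
    ultimately have "a \<in> history_events n" unfolding history_events_def by blast
    then show "a \<in> sigma_sets ?O (history_events n)" by (rule sigma_sets.Basic)
  next
    fix b assume "b \<in> history_events n"
    then have "b \<in> sets (data_space n)"
      by (auto simp: history_events_def intro!: measurable_sets[OF measurable_restrict_data])
    then show "b \<in> sigma_sets ?O ?G" unfolding data .
  qed
  finally show ?thesis .
qed

lemma history_eq_restrict_data: "history Y A \<Gamma> k \<omega> = restrict (data Y A \<Gamma> \<omega>) {..<k}"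
  by (simp add: history_def data_def)

context sensing_experiment_pair
begin

abbreviation total_information :: ennreal where
  "total_information \<equiv> \<integral>\<^sup>+\<omega>. (\<Sum>j. ennreal (information \<delta> (Y0 j \<omega>, A0 j \<omega>, \<Gamma>0 j \<omega>))) \<partial>M0"

text \<open>The partial sums of the information are at most its total, so the bound for histories
  holds with constants that do not depend on the length. It therefore survives approximation of
  \<open>E\<close> by history events.\<close>

lemma data_event_bound:
  fixes B l v :: real
  assumes E: "E \<in> sets (data_space n)" and "B > 0" "l > 0" "v \<ge> 0"
    and v: "total_information \<le> ennreal v"
  shows "measure M0 (data Y0 A0 \<Gamma>0 -` E \<inter> space M0)
       \<le> B * exp l * measure M1 (data Y1 A1 \<Gamma>1 -` E \<inter> space M1) + 1 / B + v / l"
proof -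
  let ?K = "B * exp l"
  let ?Q0 = "distr M0 (data_space n) (data Y0 A0 \<Gamma>0)" and ?Q1 = "distr M1 (data_space n) (data Y1 A1 \<Gamma>1)"
  interpret Q0: prob_space ?Q0 by (rule E0.prob_space_distr[OF E0.data_measurable])
  interpret Q1: prob_space ?Q1 by (rule E1.prob_space_distr[OF E1.data_measurable])
  have K: "?K > 0" using assms by simp
  have cyl: "measure ?Q0 C \<le> ?K * measure ?Q1 C + 1 / B + v / l" if "C \<in> history_events n" for C
  proof -
    obtain k D where C: "C = (\<lambda>f. restrict f {..<k}) -` D \<inter> space (data_space n)"
      and D: "D \<in> sets (history_space n k)" using \<open>C \<in> history_events n\<close> by (auto simp: history_events_def)
    have Cs: "C \<in> sets (data_space n)"
      unfolding C by (rule measurable_sets[OF measurable_restrict_data D])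
    have C0: "measure ?Q0 C = measure M0 (E0.hist k -` D \<inter> space M0)"
      using measurable_space[OF E0.data_measurable]
      by (subst measure_distr[OF E0.data_measurable Cs])
        (auto simp: C history_eq_restrict_data intro!: arg_cong[where f = "measure M0"])
    have C1: "measure ?Q1 C = measure M1 (E1.hist k -` D \<inter> space M1)"
      using measurable_space[OF E1.data_measurable]
      by (subst measure_distr[OF E1.data_measurable Cs])
        (auto simp: C history_eq_restrict_data intro!: arg_cong[where f = "measure M1"])
    have "(\<integral>\<^sup>+\<omega>. (\<Sum>j<k. ennreal (information \<delta> (Y0 j \<omega>, A0 j \<omega>, \<Gamma>0 j \<omega>))) \<partial>M0) \<le> total_information"
      by (intro nn_integral_mono sum_le_suminf) auto
    also note v
    finally have "(\<integral>\<^sup>+\<omega>. (\<Sum>j<k. ennreal (information \<delta> (Y0 j \<omega>, A0 j \<omega>, \<Gamma>0 j \<omega>))) \<partial>M0) * ennreal (1 / l)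
        \<le> ennreal v * ennreal (1 / l)"
      by (intro mult_right_mono) auto
    then have "ennreal (measure ?Q0 C) \<le> ennreal ?K * ennreal (measure ?Q1 C) + ennreal (1 / B)
        + ennreal v * ennreal (1 / l)"
      using history_event_bound[OF D assms(2,3)] unfolding C0 C1 E0.emeasure_eq_measure E1.emeasure_eq_measure
      by (meson add_left_mono order_trans)
    also have "\<dots> = ennreal (?K * measure ?Q1 C + 1 / B + v / l)"
      using assms K by (simp flip: ennreal_mult ennreal_plus)
    finally show ?thesis
      using assms K by (subst (asm) ennreal_le_iff) (auto intro!: add_nonneg_nonneg)
  qed
  have "measure ?Q0 E \<le> ?K * measure ?Q1 E + 1 / B + v / l"
  proof (rule field_le_epsilon)
    fix e :: real assume "e > 0"
    \<comment> \<open>Replacing \<open>E\<close> by \<open>C\<close> costs \<open>d\<close> on the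
      left and \<open>?K * d\<close> on the right, together exactly \<open>e\<close>.\<close>
    define d where "d = e / (?K + 1)"
    have d: "d > 0" "d * (?K + 1) = e" using \<open>e > 0\<close> K by (simp_all add: d_def)
    obtain C where C: "C \<in> history_events n" "measure ?Q0 (sym_diff E C) < d" "measure ?Q1 (sym_diff E C) < d"
      using approximate_by_algebra[OF Q0.finite_measure_axioms Q1.finite_measure_axioms
          algebra_history_events[of n] _ _ _ d(1), of E] E sets_data_space[of n] by auto
    have Cs: "C \<in> sets (data_space n)" unfolding sets_data_space using C(1) by (rule sigma_sets.Basic)
    have "measure ?Q0 E \<le> measure ?Q0 (C \<union> sym_diff E C)"
      using E Cs by (intro Q0.finite_measure_mono) auto
    also have "\<dots> \<le> measure ?Q0 C + measure ?Q0 (sym_diff E C)"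
      using E Cs by (intro measure_Un_le) auto
    finally have 0: "measure ?Q0 E \<le> measure ?Q0 C + d" using C(2) by simp
    have "measure ?Q1 C \<le> measure ?Q1 (E \<union> sym_diff E C)"
      using E Cs by (intro Q1.finite_measure_mono) auto
    also have "\<dots> \<le> measure ?Q1 E + measure ?Q1 (sym_diff E C)"
      using E Cs by (intro measure_Un_le) auto
    finally have "measure ?Q1 C \<le> measure ?Q1 E + d" using C(3) by simp
    then have "?K * measure ?Q1 C \<le> ?K * (measure ?Q1 E + d)"
      using K by (intro mult_left_mono) auto
    with 0 cyl[OF C(1)] have "measure ?Q0 E \<le> ?K * measure ?Q1 E + 1 / B + v / l + d * (?K + 1)"
      by (simp add: algebra_simps)
    then show "measure ?Q0 E \<le> ?K * measure ?Q1 E + 1 / B + v / l + e" unfolding d(2) .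
  qed
  then show ?thesis
    by (simp add: measure_distr[OF E0.data_measurable E] measure_distr[OF E1.data_measurable E])
qed

end

section \<open>Averaging over supports\<close>

lemma suminf_ennreal_sum:
  fixes f :: "'a \<Rightarrow> nat \<Rightarrow> ennreal"
  shows "(\<Sum>i\<in>I. \<Sum>j. f i j) = (\<Sum>j. \<Sum>i\<in>I. f i j)"
  by (rule suminf_sum[symmetric]) simp

context sensing_experiment
begin

text \<open>\<open>total_information\<close> for a shift of the single entry \<open>i\<close>,
  expressed inside one experiment so that it can be summed over \<open>i\<close> with no second
  experiment fixed.\<close>

definition entry_information :: "real \<Rightarrow> nat \<Rightarrow> ennreal" where
  "entry_information \<mu> i =
     (\<integral>\<^sup>+\<omega>. (\<Sum>j. ennreal (information (\<lambda>a. if a = i then \<mu> else 0) (Y j \<omega>, A j \<omega>, \<Gamma> j \<omega>))) \<partial>M)"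

text \<open>Each measurement probes a single entry, so its precision is charged to at most one
  \<open>i\<close>. All entries thus share one budget instead of each having its own.\<close>

lemma sum_entry_information:
  assumes "finite I"
  shows "(\<Sum>i\<in>I. entry_information \<mu> i) \<le> ennreal (\<mu>\<^sup>2 * m)"
proof -
  let ?f = "\<lambda>i j \<omega>. ennreal (information (\<lambda>a. if a = i then \<mu> else 0) (Y j \<omega>, A j \<omega>, \<Gamma> j \<omega>))"
  have meas: "?f i j \<in> borel_measurable M" for i j
    by (rule measurable_compose[OF measurable_compose[OF observation_measurable measurable_information]
          measurable_ennreal])
  have "(\<Sum>i\<in>I. ?f i j \<omega>) \<le> ennreal (\<mu>\<^sup>2) * ennreal ((\<Gamma> j \<omega>)\<^sup>2)" for j \<omega>
  proof -
    have "?f i j \<omega> = (if A j \<omega> = i then ennreal (\<mu>\<^sup>2) * ennreal ((\<Gamma> j \<omega>)\<^sup>2) else 0)" for i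
      by (simp add: information_def power_mult_distrib ennreal_mult)
    then have "(\<Sum>i\<in>I. ?f i j \<omega>) = (\<Sum>i\<in>I. if A j \<omega> = i then ennreal (\<mu>\<^sup>2) * ennreal ((\<Gamma> j \<omega>)\<^sup>2) else 0)"
      by (rule sum.cong[OF refl])
    then show ?thesis unfolding sum.delta'[OF assms] by simp
  qed
  then have pointwise: "(\<Sum>j. \<Sum>i\<in>I. ?f i j \<omega>) \<le> ennreal (\<mu>\<^sup>2) * (\<Sum>j. ennreal ((\<Gamma> j \<omega>)\<^sup>2))" for \<omega>
    by (subst ennreal_suminf_cmult[symmetric]) (intro suminf_le summableI)
  have "(\<Sum>i\<in>I. entry_information \<mu> i) = (\<integral>\<^sup>+\<omega>. (\<Sum>j. \<Sum>i\<in>I. ?f i j \<omega>) \<partial>M)"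
    unfolding entry_information_def suminf_ennreal_sum[symmetric]
    by (intro nn_integral_sum[symmetric] borel_measurable_suminf_order meas)
  also have "\<dots> \<le> (\<integral>\<^sup>+\<omega>. ennreal (\<mu>\<^sup>2) * (\<Sum>j. ennreal ((\<Gamma> j \<omega>)\<^sup>2)) \<partial>M)"
    by (intro nn_integral_mono pointwise)
  also have "\<dots> \<le> (\<integral>\<^sup>+\<omega>. ennreal (\<mu>\<^sup>2) * ennreal m \<partial>M)"
    by (rule nn_integral_mono_AE[OF eventually_mono[OF budget]]) (rule mult_left_mono, simp_all)
  also have "\<dots> = ennreal (\<mu>\<^sup>2 * m)"
    by (simp add: emeasure_space_1 ennreal_mult')
  finally show ?thesis .
qed

end

context prob_space
begin

lemma sum_prob_notin:
  assumes T: "T \<in> M \<rightarrow>\<^sub>M count_space \<T>" and "finite F"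
  shows "(\<Sum>i\<in>F. prob {\<omega> \<in> space M. i \<notin> T \<omega>}) = expectation (\<lambda>\<omega>. real (card (F - T \<omega>)))"
proof -
  have event: "{\<omega> \<in> space M. i \<notin> T \<omega>} \<in> events" for i
  proof -
    have "{\<omega> \<in> space M. i \<notin> T \<omega>} = T -` {X \<in> \<T>. i \<notin> X} \<inter> space M"
      using measurable_space[OF T] by auto
    then show ?thesis using measurable_sets[OF T, of "{X \<in> \<T>. i \<notin> X}"] by auto
  qed
  have "real (card (F - T \<omega>)) = (\<Sum>i\<in>F. indicator {\<omega> \<in> space M. i \<notin> T \<omega>} \<omega>)" if "\<omega> \<in> space M" for \<omega>
  proof -
    have "(\<Sum>i\<in>F. indicator {\<omega> \<in> space M. i \<notin> T \<omega>} \<omega>) = (\<Sum>i\<in>F. if i \<in> F - T \<omega> then 1 else 0 :: real)"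
      using that by (intro sum.cong) auto
    also have "\<dots> = real (card (F - T \<omega>))"
      using \<open>finite F\<close> by (simp add: sum.If_cases Diff_eq Compl_eq)
    finally show ?thesis by simp
  qed
  then have "expectation (\<lambda>\<omega>. real (card (F - T \<omega>)))
      = expectation (\<lambda>\<omega>. \<Sum>i\<in>F. indicator {\<omega> \<in> space M. i \<notin> T \<omega>} \<omega>)"
    by (intro Bochner_Integration.integral_cong) auto
  also have "\<dots> = (\<Sum>i\<in>F. expectation (indicator {\<omega> \<in> space M. i \<notin> T \<omega>}))"
    using event by (intro Bochner_Integration.integral_sum) (auto simp: emeasure_eq_measure)
  also have "\<dots> = (\<Sum>i\<in>F. prob {\<omega> \<in> space M. i \<notin> T \<omega>})"
    using event by simp
  finally show ?thesis by simp
qed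

lemma integrable_finite_set_valued:
  fixes g :: "'b \<Rightarrow> real"
  assumes T: "T \<in> M \<rightarrow>\<^sub>M count_space \<T>" and "finite \<T>"
  shows "integrable M (\<lambda>\<omega>. g (T \<omega>))"
proof (rule integrable_const_bound[where B = "Max ((\<lambda>X. \<bar>g X\<bar>) ` \<T>)"])
  show "AE \<omega> in M. norm (g (T \<omega>)) \<le> Max ((\<lambda>X. \<bar>g X\<bar>) ` \<T>)"
    using measurable_space[OF T] \<open>finite \<T>\<close> by (auto intro!: Max_ge)
  show "(\<lambda>\<omega>. g (T \<omega>)) \<in> borel_measurable M"
    using T by (rule measurable_compose) simp
qed

lemma sum_prob_notin_eq_NDR:
  assumes T: "T \<in> M \<rightarrow>\<^sub>M count_space \<T>" and "finite S"
  shows "(\<Sum>i\<in>S. prob {\<omega> \<in> space M. i \<notin> T \<omega>}) = real (card S) * NDR M T S"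
proof (cases "S = {}")
  case False
  then show ?thesis
    using \<open>finite S\<close> by (simp add: sum_prob_notin[OF T] NDR_def)
qed simp

text \<open>The FDR has a random denominator and must be turned into a count. Either there are at
  most \<open>s\<close> false discoveries, or they outnumber \<open>S\<close> and make up at least
  half of the estimate. In the second case the false discovery proportion is at least 1/2, so
  \<open>2 * n\<close> times it dominates the trivial bound \<open>n\<close>.\<close>

lemma sum_prob_notin_ge_FDR:
  assumes T: "T \<in> M \<rightarrow>\<^sub>M count_space (Pow {1..n})" and S: "S \<subseteq> {1..n}" "card S \<le> s"
  shows "(\<Sum>i\<in>{1..n} - S. prob {\<omega> \<in> space M. i \<notin> T \<omega>})
           \<ge> real (card ({1..n} - S)) - real s - 2 * real n * FDR M T S"
proof -
  have finS: "finite S" using S(1) finite_subset by auto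
  have pointwise: "real (card ({1..n} - S)) - real s - 2 * real n * (real (card (X - S)) / real (card X))
      \<le> real (card ({1..n} - S - X))" if "X \<in> Pow {1..n}" for X
  proof -
    have X: "X \<subseteq> {1..n}" "finite X" using that finite_subset by auto
    have "card ({1..n} - S) = card (({1..n} - S - X) \<union> (X - S))"
      using X by (intro arg_cong[where f = card]) auto
    also have "\<dots> = card ({1..n} - S - X) + card (X - S)"
      using X by (intro card_Un_disjoint) auto
    finally have split: "card ({1..n} - S) = card ({1..n} - S - X) + card (X - S)" .
    have "real (card (X - S)) \<le> real s + 2 * real n * (real (card (X - S)) / real (card X))"
    proof (cases "card (X - S) \<le> s")
      case False
      have "card X = card (X \<inter> S) + card (X - S)"
        using X by (subst card_Un_disjoint[symmetric]) (auto intro: arg_cong[where f = card])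
      moreover have "card (X \<inter> S) \<le> card S" using finS by (intro card_mono) auto
      ultimately have "0 < card X" "card X \<le> 2 * card (X - S)" using False S(2) by linarith+
      then have half: "1 \<le> 2 * (real (card (X - S)) / real (card X))" by simp
      have "card (X - S) \<le> n" using card_mono[of "{1..n}" "X - S"] X by auto
      then have "real (card (X - S)) \<le> real n * 1" by simp
      also have "\<dots> \<le> real n * (2 * (real (card (X - S)) / real (card X)))"
        using half by (intro mult_left_mono) auto
      finally have "real (card (X - S)) \<le> 2 * real n * (real (card (X - S)) / real (card X))"
        by (simp only: mult.assoc mult.left_commute[of "real n"])
      then show ?thesis by linarith
    qed (simp add: add_increasing2)
    then show ?thesis using split by linarith
  qed
  let ?r = "\<lambda>\<omega>. real (card (T \<omega> - S)) / real (card (T \<omega>))"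
  have int: "integrable M (\<lambda>\<omega>. c - d * g \<omega>)" "expectation (\<lambda>\<omega>. c - d * g \<omega>) = c - d * expectation g"
    if "integrable M g" for c d :: real and g
    using that by (simp_all add: prob_space)
  have r: "integrable M ?r"
    by (rule integrable_finite_set_valued[OF T]) simp
  have "real (card ({1..n} - S)) - real s - 2 * real n * FDR M T S
      = expectation (\<lambda>\<omega>. real (card ({1..n} - S)) - real s - 2 * real n * ?r \<omega>)"
    unfolding FDR_def by (rule int(2)[OF r, symmetric])
  also have "\<dots> \<le> expectation (\<lambda>\<omega>. real (card ({1..n} - S - T \<omega>)))"
  proof (rule integral_mono)
    show "integrable M (\<lambda>\<omega>. real (card ({1..n} - S)) - real s - 2 * real n * ?r \<omega>)"
      by (rule int(1)[OF r])
    show "integrable M (\<lambda>\<omega>. real (card ({1..n} - S - T \<omega>)))"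
      by (rule integrable_finite_set_valued[OF T]) simp
    fix \<omega> assume "\<omega> \<in> space M"
    then have "T \<omega> \<in> Pow {1..n}" using measurable_space[OF T] by simp
    then show "real (card ({1..n} - S)) - real s - 2 * real n * ?r \<omega> \<le> real (card ({1..n} - S - T \<omega>))"
      by (rule pointwise)
  qed
  also have "\<dots> = (\<Sum>i\<in>{1..n} - S. prob {\<omega> \<in> space M. i \<notin> T \<omega>})"
    by (subst sum_prob_notin[OF T]) auto
  finally show ?thesis .
qed

end

lemma FDR_nonneg: "0 \<le> FDR M T S"
  unfolding FDR_def by (rule Bochner_Integration.integral_nonneg) auto

lemma NDR_nonneg: "0 \<le> NDR M T S"
  unfolding NDR_def by (rule Bochner_Integration.integral_nonneg) auto

text \<open>Double counting of pairs: a set with a new element corresponds to the enlarged set with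
  one of its members marked. This converts sums over added entries into the sums over members that
  the NDR controls.\<close>

lemma sum_insert_card:
  fixes F :: "nat set \<Rightarrow> nat \<Rightarrow> real"
  assumes "finite V"
  shows "(\<Sum>S\<in>{S. S \<subseteq> V \<and> card S = k}. \<Sum>i\<in>V - S. F (insert i S) i)
       = (\<Sum>S\<in>{S. S \<subseteq> V \<and> card S = Suc k}. \<Sum>i\<in>S. F S i)"
proof -
  have fin: "finite S" if "S \<subseteq> V" for S using that \<open>finite V\<close> finite_subset by blast
  have "(\<Sum>S\<in>{S. S \<subseteq> V \<and> card S = k}. \<Sum>i\<in>V - S. F (insert i S) i)
      = (\<Sum>(S, i)\<in>(SIGMA S:{S. S \<subseteq> V \<and> card S = k}. V - S). F (insert i S) i)"
    using \<open>finite V\<close> by (intro sum.Sigma) auto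
  also have "\<dots> = (\<Sum>(S, i)\<in>(SIGMA S:{S. S \<subseteq> V \<and> card S = Suc k}. S). F S i)"
    by (rule sum.reindex_bij_witness[where i = "\<lambda>(S, i). (S - {i}, i)" and j = "\<lambda>(S, i). (insert i S, i)"])
      (auto simp: fin insert_absorb)
  also have "\<dots> = (\<Sum>S\<in>{S. S \<subseteq> V \<and> card S = Suc k}. \<Sum>i\<in>S. F S i)"
    using \<open>finite V\<close> fin by (intro sum.Sigma[symmetric]) auto
  finally show ?thesis .
qed

text \<open>The left side is what the FDR forces: a lower bound for the expected number of missed
  entries outside a set of size \<open>s - 1\<close>. The right side is what the NDR at size
  \<open>s\<close> allows after the change of signal, averaged over all such sets, plus the
  truncation losses: \<open>B\<close> caps the opposite likelihood ratio and \<open>l\<close> the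
  information.\<close>

lemma estimation_error_bound:
  fixes P :: "nat set \<Rightarrow> 'w measure" and Y \<Gamma> W :: "nat set \<Rightarrow> nat \<Rightarrow> 'w \<Rightarrow> real"
    and A :: "nat set \<Rightarrow> nat \<Rightarrow> 'w \<Rightarrow> nat" and Shat :: "(nat \<Rightarrow> observation) \<Rightarrow> nat set"
  defines "T \<equiv> \<lambda>S \<omega>. Shat (data (Y S) (A S) (\<Gamma> S) \<omega>)"
  assumes strategy: "sensing_strategy n \<kappa>" and est: "estimator n Shat"
    and exper: "\<And>S. S \<subseteq> {1..n} \<Longrightarrow>
      sensing_experiment (P S) n m (signal \<mu> S) \<kappa> (Y S) (A S) (\<Gamma> S) (W S)"
    and "m > 0" "1 \<le> s" "s \<le> n"
    and err: "\<And>S. S \<in> support_class n s \<Longrightarrow> FDR (P S) (T S) S + NDR (P S) (T S) S \<le> \<epsilon>"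
    and "B > 0" "l > 0"
  shows "real (n + 1 - s) - real s - 2 * real n * \<epsilon>
      \<le> B * exp l * (real (n + 1 - s) * \<epsilon>) + real (n + 1 - s) / B + \<mu>\<^sup>2 * m / l"
proof -
  let ?V = "{1..n}" and ?p = "real (n + 1 - s)" and ?K = "B * exp l"
  let ?C = "\<lambda>k. {S. S \<subseteq> ?V \<and> card S = k}"
  define miss where "miss S i = measure (P S) {\<omega> \<in> space (P S). i \<notin> T S \<omega>}" for S i
  have T: "T S \<in> P S \<rightarrow>\<^sub>M count_space (Pow ?V)" if "S \<subseteq> ?V" for S
  proof -
    interpret sensing_experiment "P S" n m "signal \<mu> S" \<kappa> "Y S" "A S" "\<Gamma> S" "W S"
      using exper[OF that] .
    show ?thesis
      unfolding T_def using est[unfolded estimator_def] by (rule measurable_compose[OF data_measurable])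
  qed
  have prob: "prob_space (P S)" if "S \<subseteq> ?V" for S
    using exper[OF that] by (simp add: sensing_experiment_def)
  have FDR_le: "FDR (P S) (T S) S \<le> \<epsilon>" if "S \<in> ?C (s - 1)" for S
    using err[of S] that NDR_nonneg[of "P S" "T S" S] by (auto simp: support_class_def)
  have NDR_le: "NDR (P S) (T S) S \<le> \<epsilon>" if "S \<in> ?C s" for S
    using err[of S] that FDR_nonneg[of "P S" "T S" S] by (auto simp: support_class_def)
  have compare: "?p - real s - 2 * real n * \<epsilon>
      \<le> ?K * (\<Sum>i\<in>?V - S. miss (insert i S) i) + ?p / B + \<mu>\<^sup>2 * m / l"
    if S: "S \<in> ?C (s - 1)" for S
  proof -
    have SV: "S \<subseteq> ?V" "card S = s - 1" using S by auto
    have finS: "finite S" using SV(1) finite_subset by blast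
    \<comment> \<open>The number of entries that can be added is \<open>n - (s - 1)\<close>;
      \<open>1 \<le> s \<le> n\<close> keeps the truncated subtractions exact.\<close>
    have card_compl: "card (?V - S) = n + 1 - s"
      using SV(2) \<open>1 \<le> s\<close> \<open>s \<le> n\<close> unfolding card_Diff_subset[OF finS SV(1)] card_atLeastAtMost by linarith
    interpret E0: sensing_experiment "P S" n m "signal \<mu> S" \<kappa> "Y S" "A S" "\<Gamma> S" "W S"
      by (rule exper[OF SV(1)])
    define v where "v i = enn2real (E0.entry_information \<mu> i)" for i
    have fin: "E0.entry_information \<mu> i < top" for i
      using E0.sum_entry_information[of "{i}" \<mu>] by (simp add: le_less_trans)
    have sum_v: "(\<Sum>i\<in>?V - S. v i) \<le> \<mu>\<^sup>2 * m"
    proof -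
      have "ennreal (\<Sum>i\<in>?V - S. v i) = (\<Sum>i\<in>?V - S. E0.entry_information \<mu> i)"
        unfolding v_def using fin by (subst sum_ennreal[symmetric]) auto
      also have "\<dots> \<le> ennreal (\<mu>\<^sup>2 * m)" by (rule E0.sum_entry_information) simp
      finally show ?thesis using \<open>m > 0\<close> by (subst (asm) ennreal_le_iff) auto
    qed
    have event: "miss S i \<le> ?K * miss (insert i S) i + 1 / B + v i / l" if i: "i \<in> ?V - S" for i
    proof -
      let ?S = "insert i S"
      have S': "?S \<subseteq> ?V" using SV i by auto
      have sig: "signal \<mu> ?S = (\<lambda>a. signal \<mu> S a + (if a = i then \<mu> else 0))"
        using i by (auto simp: signal_def fun_eq_iff)
      interpret sensing_experiment_pair n m m "signal \<mu> S" "\<lambda>a. if a = i then \<mu> else 0" \<kappa>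
        "P S" "Y S" "A S" "\<Gamma> S" "W S" "P ?S" "Y ?S" "A ?S" "\<Gamma> ?S" "W ?S"
        unfolding sensing_experiment_pair_def sensing_experiment_pair_axioms_def
        using E0.sensing_experiment_axioms exper[OF S'] strategy unfolding sig by simp
      \<comment> \<open>Missing \<open>i\<close> is expressed as a set of data, so that one and the
        same event is evaluated under both supports.\<close>
      let ?E = "Shat -` {X \<in> Pow ?V. i \<notin> X} \<inter> space (data_space n)"
      have E: "?E \<in> sets (data_space n)"
        using est unfolding estimator_def by (rule measurable_sets) auto
      have miss_eq: "miss R i = measure (P R) (data (Y R) (A R) (\<Gamma> R) -` ?E \<inter> space (P R))"
        if "R \<subseteq> ?V" for R
      proof -
        interpret R: sensing_experiment "P R" n m "signal \<mu> R" \<kappa> "Y R" "A R" "\<Gamma> R" "W R"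
          by (rule exper[OF that])
        show ?thesis
          unfolding miss_def using measurable_space[OF R.data_measurable] measurable_space[OF T[OF that]]
          by (intro arg_cong[where f = "measure (P R)"]) (auto simp: T_def)
      qed
      show ?thesis
        unfolding miss_eq[OF SV(1)] miss_eq[OF S']
        using fin[of i] \<open>B > 0\<close> \<open>l > 0\<close>
        by (intro data_event_bound[OF E]) (auto simp: v_def E0.entry_information_def)
    qed
    have "?p - real s - 2 * real n * \<epsilon> \<le> ?p - real s - 2 * real n * FDR (P S) (T S) S"
      using FDR_le[OF S] by (simp add: mult_left_mono)
    also have "\<dots> \<le> (\<Sum>i\<in>?V - S. miss S i)"
      using E0.sum_prob_notin_ge_FDR[OF T[OF SV(1)] SV(1), of s] SV(2)
      unfolding miss_def card_compl by simp
    also have "\<dots> \<le> (\<Sum>i\<in>?V - S. ?K * miss (insert i S) i + 1 / B + v i / l)"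
      by (intro sum_mono event)
    also have "\<dots> = ?K * (\<Sum>i\<in>?V - S. miss (insert i S) i) + ?p / B + (\<Sum>i\<in>?V - S. v i) / l"
      by (simp only: sum.distrib sum_constant card_compl sum_distrib_left sum_divide_distrib) simp
    also have "(\<Sum>i\<in>?V - S. v i) / l \<le> \<mu>\<^sup>2 * m / l"
      using sum_v \<open>l > 0\<close> by (intro divide_right_mono) auto
    finally show ?thesis by simp
  qed
  let ?N = "\<lambda>k. real (card (?C k))"
  have Suc_s: "Suc (s - 1) = s" using \<open>1 \<le> s\<close> by simp
  \<comment> \<open>Double counting with constant weight 1. It renormalizes the NDR total, taken
    over sets of size \<open>s\<close>, to an amount per set of size \<open>s - 1\<close>, so that
    the number of sets cancels at the end.\<close>
  have count: "?N s * real s = ?N (s - 1) * ?p"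
  proof -
    have "(\<Sum>S\<in>?C (s - 1). \<Sum>i\<in>?V - S. 1) = (\<Sum>S\<in>?C s. \<Sum>i\<in>S. 1 :: real)"
      using sum_insert_card[of ?V "\<lambda>_ _. 1" "s - 1"] by (simp only: Suc_s finite_atLeastAtMost)
    moreover have "(\<Sum>S\<in>?C (s - 1). \<Sum>i\<in>?V - S. 1 :: real) = (\<Sum>S\<in>?C (s - 1). ?p)"
    proof (rule sum.cong)
      fix S assume "S \<in> ?C (s - 1)"
      then have "S \<subseteq> ?V" "card S = s - 1" by auto
      then have "card (?V - S) = n + 1 - s"
        using \<open>1 \<le> s\<close> \<open>s \<le> n\<close> by (subst card_Diff_subset) (auto intro: finite_subset)
      then show "(\<Sum>i\<in>?V - S. 1 :: real) = ?p" by simp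
    qed simp
    ultimately show ?thesis by simp
  qed
  have N_pos: "?N (s - 1) > 0"
  proof -
    have "{1..s - 1} \<in> ?C (s - 1)" using \<open>s \<le> n\<close> by auto
    moreover have "finite (?C (s - 1))" by simp
    ultimately have "card (?C (s - 1)) > 0" unfolding card_gt_0_iff by blast
    then show ?thesis by (simp only: of_nat_0_less_iff)
  qed
  have "(\<Sum>S\<in>?C (s - 1). \<Sum>i\<in>?V - S. miss (insert i S) i) = (\<Sum>S\<in>?C s. \<Sum>i\<in>S. miss S i)"
    using sum_insert_card[of ?V miss "s - 1"] by (simp only: Suc_s finite_atLeastAtMost)
  also have "\<dots> \<le> (\<Sum>S\<in>?C s. real s * \<epsilon>)"
  proof (rule sum_mono)
    fix S assume S: "S \<in> ?C s"
    then have SV: "S \<subseteq> ?V" "card S = s" by auto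
    have "finite S" using SV(1) finite_subset by blast
    then have "(\<Sum>i\<in>S. miss S i) = real s * NDR (P S) (T S) S"
      unfolding miss_def using prob_space.sum_prob_notin_eq_NDR[OF prob[OF SV(1)] T[OF SV(1)]] SV(2) by simp
    also have "\<dots> \<le> real s * \<epsilon>"
      using NDR_le[OF S] by (intro mult_left_mono) auto
    finally show "(\<Sum>i\<in>S. miss S i) \<le> real s * \<epsilon>" .
  qed
  also have "\<dots> = ?N (s - 1) * (?p * \<epsilon>)"
    using count by simp
  finally have total: "(\<Sum>S\<in>?C (s - 1). \<Sum>i\<in>?V - S. miss (insert i S) i) \<le> ?N (s - 1) * (?p * \<epsilon>)" .
  have "?N (s - 1) * (?p - real s - 2 * real n * \<epsilon>)
      = (\<Sum>S\<in>?C (s - 1). ?p - real s - 2 * real n * \<epsilon>)" by simp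
  also have "\<dots> \<le> (\<Sum>S\<in>?C (s - 1). ?K * (\<Sum>i\<in>?V - S. miss (insert i S) i) + (?p / B + \<mu>\<^sup>2 * m / l))"
    using compare by (intro sum_mono) (simp add: add.assoc)
  also have "\<dots> = ?K * (\<Sum>S\<in>?C (s - 1). \<Sum>i\<in>?V - S. miss (insert i S) i) + ?N (s - 1) * (?p / B + \<mu>\<^sup>2 * m / l)"
    by (simp only: sum.distrib sum_distrib_left sum_constant distrib_left)
  also have "\<dots> \<le> ?K * (?N (s - 1) * (?p * \<epsilon>)) + ?N (s - 1) * (?p / B + \<mu>\<^sup>2 * m / l)"
    using total \<open>B > 0\<close> by (intro add_right_mono mult_left_mono) auto
  also have "\<dots> = ?N (s - 1) * (?K * (?p * \<epsilon>) + ?p / B + \<mu>\<^sup>2 * m / l)"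
    by (simp only: distrib_left mult.left_commute[of ?K] add.assoc)
  finally show ?thesis using N_pos by (simp only: mult_le_cancel_left_pos)
qed

section \<open>Passage to the limit\<close>

lemma x_min_signal:
  assumes "\<mu> > 0" "S \<subseteq> {1..n}" "S \<noteq> {}"
  shows "x_min n (signal \<mu> S) = \<mu>"
proof -
  obtain i where "i \<in> S" "i \<in> {1..n}" using assms(2,3) by blast
  then have "{\<bar>signal \<mu> S i\<bar> | i. i \<in> {1..n} \<and> signal \<mu> S i \<noteq> 0} = {\<mu>}"
    using assms(1) by (auto simp: signal_def)
  then show ?thesis by (simp add: x_min_def)
qed

theorem corollary4p2:
  fixes s :: "nat \<Rightarrow> nat" and m \<mu> :: "nat \<Rightarrow> real"
    and \<kappa> :: "nat \<Rightarrow> strategy" and Shat :: "nat \<Rightarrow> (nat \<Rightarrow> observation) \<Rightarrow> nat set"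
    and P :: "nat \<Rightarrow> nat set \<Rightarrow> 'w measure"
    and Y \<Gamma> W :: "nat \<Rightarrow> nat set \<Rightarrow> nat \<Rightarrow> 'w \<Rightarrow> real"
    and A :: "nat \<Rightarrow> nat set \<Rightarrow> nat \<Rightarrow> 'w \<Rightarrow> nat"
  assumes "\<And>n. n \<ge> 1 \<Longrightarrow> s n \<ge> 1"
    and "\<And>n. n \<ge> 1 \<Longrightarrow> m n > 0"
    and "\<And>n. n \<ge> 1 \<Longrightarrow> \<mu> n > 0"
    and "(\<lambda>n. real (s n)) \<in> o(\<lambda>n. real n)"
    and "\<And>n. n \<ge> 1 \<Longrightarrow> sensing_strategy n (\<kappa> n)"
    and "\<And>n. n \<ge> 1 \<Longrightarrow> estimator n (Shat n)"
    and "\<And>n S. n \<ge> 1 \<Longrightarrow> S \<subseteq> {1..n} \<Longrightarrow>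
           sensing_experiment (P n S) n (m n) (signal (\<mu> n) S) (\<kappa> n) (Y n S) (A n S) (\<Gamma> n S) (W n S)"
    and "(\<lambda>n. Max ((\<lambda>S. FDR (P n S) (\<lambda>\<omega>. Shat n (data (Y n S) (A n S) (\<Gamma> n S) \<omega>)) S
                      + NDR (P n S) (\<lambda>\<omega>. Shat n (data (Y n S) (A n S) (\<Gamma> n S) \<omega>)) S)
                   ` support_class n (s n))) \<longlonglongrightarrow> 0"
  shows "\<exists>\<omega> :: nat \<Rightarrow> real. filterlim \<omega> at_top sequentially \<and>
           (\<forall>n\<ge>1. \<forall>S\<subseteq>{1..n}. S \<noteq> {} \<longrightarrow>
              x_min n (signal (\<mu> n) S) \<ge> \<omega> n * sqrt (real n / m n))"
proof (intro exI[of _ "\<lambda>n. \<mu> n / sqrt (real n / m n)"] conjI allI impI)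
  \<comment> \<open>\<omega> is the ratio of the two sides itself, so the inequality is an equality
    and the whole content lies in its divergence.\<close>
  fix n :: nat and S assume "1 \<le> n" "S \<subseteq> {1..n}" "S \<noteq> {}"
  then show "\<mu> n / sqrt (real n / m n) * sqrt (real n / m n) \<le> x_min n (signal (\<mu> n) S)"
    using x_min_signal assms(2,3)[of n] by simp
next
  define err where "err n = (\<lambda>S. FDR (P n S) (\<lambda>\<omega>. Shat n (data (Y n S) (A n S) (\<Gamma> n S) \<omega>)) S
                      + NDR (P n S) (\<lambda>\<omega>. Shat n (data (Y n S) (A n S) (\<Gamma> n S) \<omega>)) S)" for n
  define \<epsilon> where "\<epsilon> n = Max (err n ` support_class n (s n))" for n
  have \<epsilon>: "\<epsilon> \<longlonglongrightarrow> 0"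
    using assms(8) unfolding \<epsilon>_def err_def .
  \<comment> \<open>The quotient here is the square of the witness; as \<open>l\<close> is
    arbitrary, this is its divergence.\<close>
  have large: "\<forall>\<^sub>F n in sequentially. l / 4 \<le> (\<mu> n)\<^sup>2 * m n / real n" if "l > 0" for l :: real
  proof -
    define q where "q = 2 + 2 * exp l"
    \<comment> \<open>With \<open>B = 2\<close> the terms containing \<epsilon> add up to at most
      \<open>n * q * \<epsilon>\<close>; an \<epsilon> below \<open>c\<close> makes this at most
      \<open>n / 16\<close>.\<close>
    define c where "c = 1 / (16 * q)"
    have "q > 0" by (simp add: q_def add_pos_pos)
    then have "c > 0" by (simp add: c_def)
    then have "\<forall>\<^sub>F n in sequentially. \<epsilon> n < c"
      by (rule order_tendstoD(2)[OF \<epsilon>])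
    moreover have "\<forall>\<^sub>F n in sequentially. norm (real (s n)) \<le> (1 / 8) * norm (real n)"
      by (rule landau_o.smallD[OF assms(4)]) simp
    moreover have "\<forall>\<^sub>F n in sequentially. 1 \<le> n"
      by (rule eventually_ge_at_top)
    ultimately show ?thesis
    proof eventually_elim
      case (elim n)
      have n: "1 \<le> n" using elim by simp
      have s: "1 \<le> s n" "s n \<le> n" "8 * real (s n) \<le> real n"
        using assms(1)[OF n] elim by auto
      have fin: "finite (support_class n (s n))"
        by (rule finite_subset[of _ "Pow {1..n}"]) (auto simp: support_class_def)
      have err_le: "err n S \<le> \<epsilon> n" if "S \<in> support_class n (s n)" for S
        unfolding \<epsilon>_def using fin that by (intro Max_ge) auto
      \<comment> \<open>A member of the class is needed to see that the maximum is nonnegative; this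
        permits replacing \<open>?p * \<epsilon>\<close> by \<open>n * \<epsilon>\<close>
        below.\<close>
      have "{1..s n} \<in> support_class n (s n)"
        using s by (auto simp: support_class_def)
      from err_le[OF this] have nonneg: "0 \<le> \<epsilon> n"
        unfolding err_def by (meson add_nonneg_nonneg FDR_nonneg NDR_nonneg order_trans)
      let ?p = "real (n + 1 - s n)"
      have p: "?p \<le> real n" "real n - real (s n) \<le> ?p" using s by auto
      \<comment> \<open>The choice \<open>B = 2\<close> sacrifices half of \<open>?p\<close>. Since
        \<open>?p \<ge> n - s\<close> and \<open>s \<le> n / 8\<close>, at least
        \<open>n / 2 - 3 * n / 16\<close> remains, and the \<epsilon>-terms take at most
        \<open>n / 16\<close> of it, which leaves \<open>n / 4\<close>.\<close>
      have "?p - real (s n) - 2 * real n * \<epsilon> n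
          \<le> 2 * exp l * (?p * \<epsilon> n) + ?p / 2 + (\<mu> n)\<^sup>2 * m n / l"
        using assms(2,5,6,7)[OF n] s err_le \<open>l > 0\<close>
        by (intro estimation_error_bound[where P = "P n" and Y = "Y n" and A = "A n" and \<Gamma> = "\<Gamma> n"
              and W = "W n" and \<kappa> = "\<kappa> n" and Shat = "Shat n"]) (auto simp: err_def)
      moreover have "2 * exp l * (?p * \<epsilon> n) \<le> 2 * exp l * (real n * \<epsilon> n)"
        using p nonneg by (intro mult_left_mono mult_right_mono) auto
      moreover have "q * \<epsilon> n \<le> q * c"
        using elim \<open>q > 0\<close> by (intro mult_left_mono) auto
      then have "q * \<epsilon> n \<le> 1 / 16"
        using \<open>q > 0\<close> by (simp add: c_def)
      then have "real n * ((2 + 2 * exp l) * \<epsilon> n) \<le> real n * (1 / 16)"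
        unfolding q_def by (rule mult_left_mono) simp
      then have "2 * real n * \<epsilon> n + 2 * exp l * (real n * \<epsilon> n) \<le> real n / 16"
        by (simp add: algebra_simps)
      ultimately have "real n / 4 \<le> (\<mu> n)\<^sup>2 * m n / l"
        using p s by linarith
      then show ?case
        using n \<open>l > 0\<close> by (simp add: field_simps)
    qed
  qed
  show "filterlim (\<lambda>n. \<mu> n / sqrt (real n / m n)) at_top sequentially"
    unfolding filterlim_at_top
  proof
    fix z :: real
    \<comment> \<open>The factor 4 cancels the one in \<open>large\<close>, and the added 1 keeps
      \<open>l\<close> positive for \<open>z = 0\<close>. Comparing squares is enough for negative
      \<open>z\<close> as well, because the witness is nonnegative.\<close>
    have "\<forall>\<^sub>F n in sequentially. (4 * (z\<^sup>2 + 1)) / 4 \<le> (\<mu> n)\<^sup>2 * m n / real n"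
      by (rule large) (simp add: add_nonneg_pos)
    moreover have "\<forall>\<^sub>F n::nat in sequentially. 1 \<le> n"
      by (rule eventually_ge_at_top)
    ultimately show "\<forall>\<^sub>F n in sequentially. z \<le> \<mu> n / sqrt (real n / m n)"
    proof eventually_elim
      case (elim n)
      have pos: "m n > 0" "\<mu> n > 0" "real n > 0" using assms(2,3)[of n] elim by auto
      have "(\<mu> n / sqrt (real n / m n))\<^sup>2 = (\<mu> n)\<^sup>2 * m n / real n"
        using pos by (simp add: power_divide)
      moreover have "z\<^sup>2 \<le> (4 * (z\<^sup>2 + 1)) / 4" by simp
      ultimately have "z\<^sup>2 \<le> (\<mu> n / sqrt (real n / m n))\<^sup>2"
        using elim(1) by (simp only: order_trans)
      then show ?case by (rule power2_le_imp_le) (use pos in simp)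
    qed
  qed
qed

end
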